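(* Consider the geometric model. Let $q\in(0,1)$ and $0<l,m<\sqrt{q}$. Suppose that $\alpha$ and $\beta$ are the distributions with densities proportional to $x\mapsto 1/x$ on the intervals $[\sqrt{q}-l,\sqrt{q}]$ and $[\sqrt{q}-m,\sqrt{q}]$, respectively. Then, for all $s,t>0$, the shape function $g$ satisfies $$\begin{aligned}g(s,t)&=\frac{s}{L}\log\left(1+\frac{l\sqrt{q}}{1-q}+\frac{l}{1-q}\cdot\frac{ly-mx+\sqrt{(ly-mx)^2+4xy(1+m\sqrt{q}-q)(1+l\sqrt{q}-q)}}{2x(1+m\sqrt{q}-q)}\right)\\&\quad+\frac{t}{M}\log\left(1+\frac{m\sqrt{q}}{1-q}+\frac{m}{1-q}\cdot\frac{mx-ly+\sqrt{(ly-mx)^2+4xy(1+m\sqrt{q}-q)(1+l\sqrt{q}-q)}}{2y(1+l\sqrt{q}-q)}\right),\end{aligned}$$ where $x=slM$, $y=tmL$, $L=\log\left(\dfrac{\sqrt{q}}{\sqrt{q}-l}\right)$ and $M=\log\left(\dfrac{\sqrt{q}}{\sqrt{q}-m}\right)$.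
   Context: $\mathbb{N}=\{1,2,\dots\}$, $\mathbb{Z}_+=\{0,1,2,\dots\}$, $\mathbb{R}_+=[0,\infty)$; $\lfloor x\rfloor$ is the integer part; $x\vee y=\max\{x,y\}$. Environment. Let $\mathbf{a}=(a_n)_{n\in\mathbb{N}}$ and $\mathbf{b}=(b_n)_{n\in\mathbb{N}}$ be stationary random sequences in $(0,1)$, and let $\mu$ be the distribution of $(\mathbf{a},\mathbf{b})$. For $k\in\mathbb{Z}_+$ let $\tau_k$ be the shift $(c_n)_{n\in\mathbb{N}}\mapsto(c_{n+k})_{n\in\mathbb{N}}$. It is assumed that $\mu$ is (stationary and) ergodic under the map $\tau_k\times\tau_l:(\mathbf{a},\mathbf{b})\mapsto(\tau_k\mathbf{a},\tau_l\mathbf{b})$ for each $k,l\in\mathbb{N}$. Let $\alpha,\beta$ be the distributions of $a_1,b_1$ under $\mu$. Geometric model. Given $(\mathbf{a},\mathbf{b})$, the weights $W(i,j)$, $i,j\in\mathbb{N}$, are (conditionally) independent and $W(i,j)$ is geometric with parameter $a_ib_j$, i.e. $\mathbf{P}_{\mathbf{a},\mathbf{b}}(W(i,j)\ge k)=a_i^kb_j^k$ for $k\in\mathbb{Z}_+$ (values in $\mathbb{Z}_+$). Here $\mathbf{P}_{\mathbf{a},\mathbf{b}}$ is the conditional joint law (a product measure on $\mathbb{R}_+^{\mathbb{N}^2}$), and $\mathbb{P}(\cdot)=\int\mathbf{P}_{\mathbf{a},\mathbf{b}}(\cdot)\,\mu(d\mathbf{a},d\mathbf{b})$ is the joint law of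 the weights. Last-passage times. $G(i,j)=G(i-1,j)\vee G(i,j-1)+W(i,j)$ for $i,j\in\mathbb{N}$, with $G(i,0)=G(0,j)=0$. Equivalently, $G(m,n)$ is the maximum over all directed paths $\pi$ from $(1,1)$ to $(m,n)$ with steps $(1,0)$ or $(0,1)$ of $\sum_{(i,j)\in\pi}W(i,j)$. Shape function. There is a deterministic function $g:(0,\infty)^2\to[0,\infty]$, called the shape function, such that $\mathbb{P}$-a.s. $\lim_{n\to\infty}G(\lfloor ns\rfloor,\lfloor nt\rfloor)/n=g(s,t)$ for all $s,t>0$. *)

theory Defs
  imports "HOL-Probability.Probability"
begin

text \<open>
  All sequences and arrays are indexed from \<open>0\<close>: \<open>a n\<close>, \<open>b n\<close> and \<open>W (i, j)\<close> stand for
  $a_{n+1}$, $b_{n+1}$ and $W(i+1, j+1)$.  Last-passage times, which have boundary values at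
  index \<open>0\<close>, keep their original indices.
\<close>

section \<open>Environment\<close>

definition env_space :: "((nat \<Rightarrow> real) \<times> (nat \<Rightarrow> real)) measure" where
  "env_space =
     (\<Pi>\<^sub>M n\<in>UNIV. restrict_space borel {0<..<1}) \<Otimes>\<^sub>M (\<Pi>\<^sub>M n\<in>UNIV. restrict_space borel {0<..<1})"

definition ergodic_map :: "'a measure \<Rightarrow> ('a \<Rightarrow> 'a) \<Rightarrow> bool" where
  "ergodic_map M T \<longleftrightarrow>
     prob_space M \<and> T \<in> M \<rightarrow>\<^sub>M M \<and> distr M M T = M \<and>
     (\<forall>A\<in>sets M. T -` A \<inter> space M = A \<longrightarrow> measure M A = 0 \<or> measure M A = 1)"

definition shift :: "nat \<Rightarrow> (nat \<Rightarrow> real) \<Rightarrow> (nat \<Rightarrow> real)" where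
  "shift k c = (\<lambda>n. c (n + k))"

text \<open>
  Stationarity of the two sequences is the invariance of \<open>\<mu>\<close> under \<open>map_prod (shift 1) (shift 1)\<close>,
  which is part of ergodicity.
\<close>

definition environment :: "((nat \<Rightarrow> real) \<times> (nat \<Rightarrow> real)) measure \<Rightarrow> bool" where
  "environment \<mu> \<longleftrightarrow>
     prob_space \<mu> \<and> sets \<mu> = sets env_space \<and>
     (\<forall>k\<ge>1. \<forall>l\<ge>1. ergodic_map \<mu> (map_prod (shift k) (shift l)))"

definition a_law :: "((nat \<Rightarrow> real) \<times> (nat \<Rightarrow> real)) measure \<Rightarrow> real measure" where
  "a_law \<mu> = distr \<mu> borel (\<lambda>(a, b). a 0)"

definition b_law :: "((nat \<Rightarrow> real) \<times> (nat \<Rightarrow> real)) measure \<Rightarrow> real measure" where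
  "b_law \<mu> = distr \<mu> borel (\<lambda>(a, b). b 0)"

definition has_density_proportional_to ::
    "real measure \<Rightarrow> (real \<Rightarrow> real) \<Rightarrow> real set \<Rightarrow> bool" where
  "has_density_proportional_to \<nu> f S \<longleftrightarrow>
     (\<exists>c>0. \<nu> = density lborel (\<lambda>x. ennreal (c * f x * indicator S x)))"

section \<open>Geometric weights\<close>

text \<open>
  The library's \<open>geometric_pmf p\<close> has mass function $n \mapsto (1-p)^n p$, so a weight
  with tails $r^k$ has law \<open>geometric_pmf (1 - r)\<close>; see \<open>geometric_weight_tail\<close>.
\<close>

definition geometric_weight :: "real \<Rightarrow> real measure" where
  "geometric_weight r = distr (measure_pmf (geometric_pmf (1 - r))) borel real"

definition quenched_law :: "(nat \<Rightarrow> real) \<Rightarrow> (nat \<Rightarrow> real) \<Rightarrow> (nat \<times> nat \<Rightarrow> real) measure" where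
  "quenched_law a b = (\<Pi>\<^sub>M (i, j)\<in>UNIV. geometric_weight (a i * b j))"

definition annealed_law ::
    "((nat \<Rightarrow> real) \<times> (nat \<Rightarrow> real)) measure \<Rightarrow> (nat \<times> nat \<Rightarrow> real) measure" where
  "annealed_law \<mu> = \<mu> \<bind> (\<lambda>(a, b). quenched_law a b)"

lemma geometric_weight_tail:
  assumes "0 < r" "r < 1"
  shows "measure (geometric_weight r) {real k..} = r ^ k"
proof -
  have r: "0 < 1 - r" "1 - r \<le> 1" using assms by auto
  have "measure (geometric_weight r) {real k..} = measure (geometric_pmf (1 - r)) {k..}"
    unfolding geometric_weight_def
    by (subst measure_distr) (auto intro!: arg_cong[where f = "measure _"])
  also have "{k..} = - {..<k}" by auto
  also have "measure (geometric_pmf (1 - r)) (- {..<k}) =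
      1 - measure (geometric_pmf (1 - r)) {..<k}"
    using measure_pmf.prob_compl[of "{..<k}" "geometric_pmf (1 - r)"]
    by (simp add: Compl_eq_Diff_UNIV)
  also have "measure (geometric_pmf (1 - r)) {..<k} = (\<Sum>n<k. r ^ n * (1 - r))"
    using r by (subst measure_measure_pmf_finite) auto
  also have "\<dots> = 1 - r ^ k"
    by (induction k) (auto simp: algebra_simps)
  finally show ?thesis by simp
qed

lemma prob_space_geometric_weight: "prob_space (geometric_weight r)"
  unfolding geometric_weight_def by (intro measure_pmf.prob_space_distr) auto

lemma sets_geometric_weight [simp, measurable_cong]: "sets (geometric_weight r) = sets borel"
  by (simp add: geometric_weight_def)

lemma emeasure_geometric_weight:
  assumes "0 < r" "r < 1" "B \<in> sets borel"
  shows "emeasure (geometric_weight r) B =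
    (\<Sum>n. ennreal (r ^ n * (1 - r)) * indicator B (real n))"
proof -
  have "emeasure (geometric_weight r) B =
      (\<integral>\<^sup>+ n. indicator (real -` B) n \<partial>measure_pmf (geometric_pmf (1 - r)))"
    unfolding geometric_weight_def using assms by (subst emeasure_distr) auto
  also have "\<dots> = (\<Sum>n. ennreal (r ^ n * (1 - r)) * indicator B (real n))"
    using assms
    by (subst nn_integral_measure_pmf, subst nn_integral_count_space_nat)
       (auto intro!: suminf_cong simp: indicator_def)
  finally show ?thesis .
qed

text \<open>
  The quenched laws form a probability kernel, so \<open>annealed_law\<close> is the genuine mixture
  (\<open>bind\<close> is unspecified for non-measurable kernels).
\<close>

lemma measurable_quenched_law:
  "(\<lambda>(a, b). quenched_law a b) \<in> env_space \<rightarrow>\<^sub>M prob_algebra (\<Pi>\<^sub>M (ij :: nat \<times> nat)\<in>UNIV. borel)"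
proof (rule measurable_prob_algebra_generated)
  show "sets (\<Pi>\<^sub>M (ij :: nat \<times> nat)\<in>UNIV. borel) =
      sigma_sets (\<Pi>\<^sub>E ij\<in>UNIV. space borel) (prod_algebra UNIV (\<lambda>ij :: nat \<times> nat. borel :: real measure))"
    by (simp add: sets_PiM)
  show "Int_stable (prod_algebra UNIV (\<lambda>ij :: nat \<times> nat. borel :: real measure))"
    by (rule Int_stable_prod_algebra)
  show "prod_algebra UNIV (\<lambda>ij :: nat \<times> nat. borel :: real measure) \<subseteq> Pow (\<Pi>\<^sub>E ij\<in>UNIV. space borel)"
    using prod_algebra_sets_into_space by blast
next
  fix e :: "(nat \<Rightarrow> real) \<times> (nat \<Rightarrow> real)"
  show "prob_space (case e of (a, b) \<Rightarrow> quenched_law a b)"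
    by (cases e)
       (auto simp: quenched_law_def intro!: prob_space_PiM prob_space_geometric_weight)
  show "sets (case e of (a, b) \<Rightarrow> quenched_law a b) = sets (\<Pi>\<^sub>M (ij :: nat \<times> nat)\<in>UNIV. borel)"
    by (cases e) (auto simp: quenched_law_def intro!: sets_PiM_cong)
next
  fix A :: "(nat \<times> nat \<Rightarrow> real) set"
  assume "A \<in> prod_algebra UNIV (\<lambda>ij. borel)"
  then obtain J E where J: "A = prod_emb UNIV (\<lambda>ij. borel) J (\<Pi>\<^sub>E ij\<in>J. E ij)"
    "finite J" "\<And>ij. ij \<in> J \<Longrightarrow> E ij \<in> sets borel"
    by (elim prod_algebraE) auto
  have "emeasure (case e of (a, b) \<Rightarrow> quenched_law a b) A =
      (\<Prod>(i, j)\<in>J. \<Sum>n. ennreal ((fst e i * snd e j) ^ n * (1 - fst e i * snd e j)) *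
        indicator (E (i, j)) (real n))" if e: "e \<in> space env_space" for e
  proof -
    obtain a b where ab: "e = (a, b)" by (cases e)
    have range: "0 < a i * b j" "a i * b j < 1" for i j
    proof -
      have "0 < a i" "a i < 1" "0 < b j" "b j < 1"
        using e by (auto simp: ab env_space_def space_pair_measure space_PiM space_restrict_space
            PiE_iff)
      then show "0 < a i * b j" "a i * b j < 1"
        using mult_strict_mono[of "a i" 1 "b j" 1] by auto
    qed
    interpret product_prob_space "\<lambda>(i, j). geometric_weight (a i * b j)" UNIV
      by (intro product_prob_spaceI) (auto simp: prob_space_geometric_weight)
    have "prod_emb UNIV (\<lambda>ij. borel) J (\<Pi>\<^sub>E ij\<in>J. E ij) =
        prod_emb UNIV (\<lambda>(i, j). geometric_weight (a i * b j)) J (\<Pi>\<^sub>E ij\<in>J. E ij)"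
      by (auto simp: prod_emb_def geometric_weight_def split: prod.splits)
    then have "emeasure (quenched_law a b) A =
        (\<Prod>ij\<in>J. emeasure (case ij of (i, j) \<Rightarrow> geometric_weight (a i * b j)) (E ij))"
      unfolding J(1) quenched_law_def using J(2,3)
      by (subst emeasure_PiM_emb[symmetric]) (auto split: prod.splits)
    also have "\<dots> = (\<Prod>(i, j)\<in>J. \<Sum>n. ennreal ((a i * b j) ^ n * (1 - a i * b j)) *
        indicator (E (i, j)) (real n))"
      by (intro prod.cong) (auto simp: emeasure_geometric_weight[OF range] J(3))
    finally show ?thesis by (simp add: ab)
  qed
  moreover have "(\<lambda>e. \<Prod>(i, j)\<in>J. \<Sum>n.
        ennreal ((fst e i * snd e j) ^ n * (1 - fst e i * snd e j)) *
        indicator (E (i, j)) (real n)) \<in> borel_measurable env_space"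
  proof -
    have coord: "(\<lambda>c. c i) \<in> borel_measurable (\<Pi>\<^sub>M n\<in>UNIV. restrict_space borel {0<..<1 :: real})"
      for i :: nat
    proof -
      have "(\<lambda>c. c i) \<in> (\<Pi>\<^sub>M n\<in>UNIV. restrict_space borel {0<..<1 :: real}) \<rightarrow>\<^sub>M
          restrict_space borel {0<..<1 :: real}"
        by measurable
      then show ?thesis by (simp add: measurable_restrict_space2_iff)
    qed
    have [measurable]: "(\<lambda>e. fst e i) \<in> borel_measurable env_space"
      "(\<lambda>e. snd e i) \<in> borel_measurable env_space" for i
      unfolding env_space_def
      by (auto intro: measurable_compose[OF measurable_fst coord]
          measurable_compose[OF measurable_snd coord])
    show ?thesis
      unfolding case_prod_beta by measurable
  qed
  ultimately show "(\<lambda>e. emeasure (case e of (a, b) \<Rightarrow> quenched_law a b) A) \<in> borel_measurable env_space"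
    by (simp cong: measurable_cong)
qed

section \<open>Last-passage times and the shape function\<close>

fun last_passage :: "(nat \<times> nat \<Rightarrow> real) \<Rightarrow> nat \<Rightarrow> nat \<Rightarrow> real" where
  "last_passage W 0 j = 0"
| "last_passage W i 0 = 0"
| "last_passage W (Suc i) (Suc j) =
     max (last_passage W i (Suc j)) (last_passage W (Suc i) j) + W (i, j)"

text \<open>
  The exceptional null set does not depend on \<open>s\<close> and \<open>t\<close>; the values of \<open>g\<close> outside
  the open quadrant are irrelevant.
\<close>

definition is_shape_function ::
    "((nat \<Rightarrow> real) \<times> (nat \<Rightarrow> real)) measure \<Rightarrow> (real \<Rightarrow> real \<Rightarrow> ereal) \<Rightarrow> bool" where
  "is_shape_function \<mu> g \<longleftrightarrow>
     (AE W in annealed_law \<mu>. \<forall>s>0. \<forall>t>0.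
        (\<lambda>n. ereal (last_passage W (nat \<lfloor>real n * s\<rfloor>) (nat \<lfloor>real n * t\<rfloor>) / real n))
          \<longlonglongrightarrow> g s t)"

end

theory Submission
  imports Defs
begin

text \<open>
  For each parameter \<open>z\<close> the corner growth model has a stationary version: geometric weights with
  parameters \<open>a\<^sub>i / z\<close> and \<open>z * b\<^sub>j\<close> are put on the two axes.  Its passage time to \<open>(N s, N t)\<close> is a sum of
  independent boundary weights along the bottom plus a sum of increments along the right side, and
  by Burke's property (\<open>burke\<close>) these increments are distributed like the weights on the left side.
  Hence it grows like \<open>N * F z\<close> with \<open>F z = s * A z + t * B z\<close>, where \<open>A z\<close> and \<open>B z\<close> are the means of
  \<open>a / (z - a)\<close> and \<open>z * b / (1 - z * b)\<close> under the laws of \<open>a\<^sub>1\<close> and \<open>b\<^sub>1\<close>.  The ergodic theorem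
  (\<open>birkhoff_ergodic\<close>) is what turns averages over a fixed environment into these means.

  As the stationary passage time dominates the original one, \<open>g s t \<le> F z\<close> for every admissible \<open>z\<close>.  At a critical
  point of \<open>F\<close> there is equality (\<open>shape_at_critical_point\<close>): a maximizing path of the stationary model
  that stays on an axis for a macroscopic distance would do too well in the stationary model with a
  slightly different parameter, which is coupled so as to have larger weights on that axis
  (\<open>last_passage_exit_split\<close>).  So maximizing paths leave the boundary early, and the two passage times
  agree to first order.

  The whole comparison takes place in one typical environment, where the limit is the constant
  \<open>g s t\<close> by assumption; convergence in probability of the bounds is therefore enough to identify it.

  For densities proportional to \<open>1 / x\<close> the functions \<open>A\<close> and \<open>B\<close> are logarithms, and the equation for
  the critical point becomes quadratic in \<open>u = (1 - z * sqrt q) / (z - sqrt q)\<close>.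
\<close>

section \<open>The ergodic theorem\<close>

definition birkhoff_sum :: "('a \<Rightarrow> 'a) \<Rightarrow> ('a \<Rightarrow> real) \<Rightarrow> nat \<Rightarrow> 'a \<Rightarrow> real" where
  "birkhoff_sum T f n x = (\<Sum>i<n. f ((T ^^ i) x))"

lemma birkhoff_sum_0 [simp]: "birkhoff_sum T f 0 x = 0"
  by (simp add: birkhoff_sum_def)

lemma birkhoff_sum_Suc: "birkhoff_sum T f (Suc n) x = f x + birkhoff_sum T f n (T x)"
  unfolding birkhoff_sum_def by (subst sum.lessThan_Suc_shift) (simp add: funpow_swap1)

text \<open>
  The maximum of the first \<open>n\<close> Birkhoff sums and \<open>0\<close>.  Written as a recursion along the orbit, it
  displays the identity that drives the maximal ergodic argument.
\<close>
fun max_birkhoff_sum :: "('a \<Rightarrow> 'a) \<Rightarrow> ('a \<Rightarrow> real) \<Rightarrow> nat \<Rightarrow> 'a \<Rightarrow> real" where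
  "max_birkhoff_sum T f 0 x = 0"
| "max_birkhoff_sum T f (Suc n) x = max 0 (f x + max_birkhoff_sum T f n (T x))"

lemma max_birkhoff_sum_nonneg: "0 \<le> max_birkhoff_sum T f n x"
  by (cases n) auto

lemma max_birkhoff_sum_mono: "max_birkhoff_sum T f n x \<le> max_birkhoff_sum T f (Suc n) x"
proof (induction n arbitrary: x)
  case (Suc n)
  show ?case using Suc[of "T x"] by auto
qed auto

lemma birkhoff_sum_le_max:
  assumes "k \<le> n" shows "birkhoff_sum T f k x \<le> max_birkhoff_sum T f n x"
  using assms
proof (induction n arbitrary: k x)
  case (Suc n)
  show ?case
  proof (cases k)
    case (Suc j)
    then have "birkhoff_sum T f j (T x) \<le> max_birkhoff_sum T f n (T x)"
      using Suc.IH[of j "T x"] Suc.prems by auto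
    then show ?thesis by (simp add: Suc birkhoff_sum_Suc)
  qed simp
qed simp

lemma ergodic_mapD:
  assumes "ergodic_map M T"
  shows "prob_space M" "T \<in> M \<rightarrow>\<^sub>M M" "distr M M T = M"
    "\<And>A. A \<in> sets M \<Longrightarrow> T -` A \<inter> space M = A \<Longrightarrow> measure M A = 0 \<or> measure M A = 1"
  using assms by (auto simp: ergodic_map_def)

text \<open>
  Garsia's maximal argument.  Being unbounded is an exactly invariant property of the sequence of
  Birkhoff sums, so by ergodicity it holds almost nowhere or almost everywhere.  Let \<open>m\<^sub>n\<close> be the
  running maximum.  Then \<open>m\<^bsub>n+1\<^esub> - m\<^sub>n \<circ> T = max f (- m\<^sub>n \<circ> T)\<close>, and the left-hand side
  has a nonnegative integral because \<open>m\<^sub>n\<close> increases and \<open>T\<close> preserves the measure.  If the sums were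
  almost everywhere unbounded, the right-hand side would tend to \<open>f\<close> and force \<open>0 \<le> \<integral>f\<close>.
\<close>
lemma birkhoff_sum_bounded:
  assumes erg: "ergodic_map M T" and f: "integrable M f" and neg: "(\<integral>x. f x \<partial>M) < 0"
  shows "AE x in M. \<exists>C. \<forall>n. birkhoff_sum T f n x \<le> C"
proof -
  interpret prob_space M using ergodic_mapD(1)[OF erg] .
  note T[measurable] = ergodic_mapD(2)[OF erg]
  have [measurable]: "f \<in> borel_measurable M" using f by auto
  have Tn[measurable]: "T ^^ n \<in> M \<rightarrow>\<^sub>M M" for n
    by (induction n) auto
  have Sm[measurable]: "birkhoff_sum T f n \<in> borel_measurable M" for n
    unfolding birkhoff_sum_def[abs_def] by measurable
  define E where "E = {x\<in>space M. \<forall>C::nat. \<exists>n. real C < birkhoff_sum T f n x}"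
  have [measurable]: "E \<in> sets M" unfolding E_def by measurable
  have step: "(\<forall>C::nat. \<exists>n. real C < birkhoff_sum T f n (T x)) \<longleftrightarrow>
      (\<forall>C::nat. \<exists>n. real C < birkhoff_sum T f n x)" (is "?L \<longleftrightarrow> ?R") for x
  proof
    assume L: ?L
    show ?R
    proof
      fix C :: nat
      obtain n where "real (C + nat \<lceil>\<bar>f x\<bar>\<rceil>) < birkhoff_sum T f n (T x)" using L by blast
      then have "real C < birkhoff_sum T f (Suc n) x" by (simp add: birkhoff_sum_Suc) linarith
      then show "\<exists>n. real C < birkhoff_sum T f n x" by blast
    qed
  next
    assume R: ?R
    show ?L
    proof
      fix C :: nat
      obtain n where n: "real (C + nat \<lceil>\<bar>f x\<bar>\<rceil>) < birkhoff_sum T f n x" using R by blast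
      then obtain k where "n = Suc k" by (cases n) (auto simp del: of_nat_add)
      then have "real C < birkhoff_sum T f k (T x)" using n by (simp add: birkhoff_sum_Suc) linarith
      then show "\<exists>n. real C < birkhoff_sum T f n (T x)" by blast
    qed
  qed
  have "T -` E \<inter> space M = E"
    using measurable_space[OF T] by (auto simp: E_def step)
  then consider "prob E = 0" | "prob E = 1"
    using ergodic_mapD(4)[OF erg, of E] by auto
  then show ?thesis
  proof cases
    case 1
    then have "AE x in M. x \<notin> E"
      by (simp add: prob_eq_0)
    then show ?thesis
      using AE_space
    proof eventually_elim
      case (elim x)
      then obtain C :: nat where "\<forall>n. \<not> real C < birkhoff_sum T f n x"
        by (auto simp: E_def)
      then show ?case by (intro exI[of _ "real C"]) (auto simp: not_less)
    qed
  next
    case 2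
    \<comment> \<open>Almost everywhere unbounded sums would make the integral of \<open>f\<close> nonnegative.\<close>
    let ?m = "max_birkhoff_sum T f"
    have mi: "integrable M (?m n)" for n
    proof (induction n)
      case 0
      then show ?case by (simp add: fun_eq_iff[symmetric])
    next
      case (Suc n)
      have "integrable (distr M M T) (?m n)" using Suc ergodic_mapD(3)[OF erg] by simp
      then have "integrable M (\<lambda>x. ?m n (T x))" by (rule integrable_distr[OF T])
      then show ?case using f by (simp add: fun_eq_iff)
    qed
    have mT: "integrable M (\<lambda>x. ?m n (T x))" "(\<integral>x. ?m n (T x) \<partial>M) = (\<integral>x. ?m n x \<partial>M)" for n
    proof -
      have "integrable (distr M M T) (?m n)" using mi[of n] ergodic_mapD(3)[OF erg] by simp
      then show "integrable M (\<lambda>x. ?m n (T x))" by (rule integrable_distr[OF T])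
      have "(\<integral>x. ?m n x \<partial>distr M M T) = (\<integral>x. ?m n (T x) \<partial>M)"
        by (rule integral_distr[OF T borel_measurable_integrable[OF mi]])
      then show "(\<integral>x. ?m n (T x) \<partial>M) = (\<integral>x. ?m n x \<partial>M)"
        using ergodic_mapD(3)[OF erg] by simp
    qed
    have "0 \<le> (\<integral>x. max (f x) (- ?m n (T x)) \<partial>M)" for n
    proof -
      have "(\<integral>x. ?m n x \<partial>M) \<le> (\<integral>x. ?m (Suc n) x \<partial>M)"
        using mi[of n] mi[of "Suc n"] by (rule integral_mono) (rule max_birkhoff_sum_mono)
      then have "0 \<le> (\<integral>x. ?m (Suc n) x \<partial>M) - (\<integral>x. ?m n (T x) \<partial>M)" by (simp only: mT)
      also have "\<dots> = (\<integral>x. ?m (Suc n) x - ?m n (T x) \<partial>M)"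
        using mi[of "Suc n"] mT(1)[of n] by (rule Bochner_Integration.integral_diff[symmetric])
      also have "(\<lambda>x. ?m (Suc n) x - ?m n (T x)) = (\<lambda>x. max (f x) (- ?m n (T x)))"
        by (auto simp: fun_eq_iff max_def)
      finally show ?thesis .
    qed
    moreover have "(\<lambda>n. \<integral>x. max (f x) (- ?m n (T x)) \<partial>M) \<longlonglongrightarrow> (\<integral>x. f x \<partial>M)"
    proof (rule integral_dominated_convergence[where w = "\<lambda>x. \<bar>f x\<bar>"])
      show "(\<lambda>x. max (f x) (- ?m n (T x))) \<in> borel_measurable M" for n
        using mT(1)[of n] by measurable
      show "AE x in M. norm (max (f x) (- ?m n (T x))) \<le> \<bar>f x\<bar>" for n
      proof (rule AE_I2)
        fix x
        show "norm (max (f x) (- ?m n (T x))) \<le> \<bar>f x\<bar>"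
          using max_birkhoff_sum_nonneg[of T f n "T x"] by (auto simp: max_def abs_if)
      qed
      have "AE x in M. x \<in> E" using 2 by (simp add: prob_eq_1)
      then show "AE x in M. (\<lambda>n. max (f x) (- ?m n (T x))) \<longlonglongrightarrow> f x"
      proof eventually_elim
        case (elim x)
        then have "\<forall>C::nat. \<exists>n. real C < birkhoff_sum T f n (T x)"
          by (subst step) (simp add: E_def)
        then obtain n where n: "real (nat \<lceil>\<bar>f x\<bar>\<rceil>) < birkhoff_sum T f n (T x)" by blast
        have "max (f x) (- ?m k (T x)) = f x" if "n \<le> k" for k
          using birkhoff_sum_le_max[OF that, of T f "T x"] n by linarith
        then show ?case
          by (intro tendsto_eventually) (auto simp: eventually_sequentially)
      qed
    qed (use f in auto)
    ultimately have "0 \<le> (\<integral>x. f x \<partial>M)"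
      by (intro LIMSEQ_le_const) auto
    then show ?thesis using neg by simp
  qed
qed

text \<open>
  Boundedness of the sums of \<open>f - c\<close>, for a sequence of constants \<open>c\<close> decreasing to \<open>\<integral>f\<close>, bounds the
  averages of \<open>f\<close> from above; the lower bound follows by passing to \<open>- f\<close>.
\<close>
lemma birkhoff_upper:
  assumes erg: "ergodic_map M T" and f: "integrable M f"
  shows "AE x in M. \<forall>e>0. \<forall>\<^sub>F n in sequentially. birkhoff_sum T f n x / n < (\<integral>x. f x \<partial>M) + e"
proof -
  interpret prob_space M using ergodic_mapD(1)[OF erg] .
  define c where "c j = (\<integral>x. f x \<partial>M) + inverse (real (Suc j))" for j
  have "AE x in M. \<exists>C. \<forall>n. birkhoff_sum T (\<lambda>x. f x - c j) n x \<le> C" for j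
    by (rule birkhoff_sum_bounded[OF erg]) (use f in \<open>auto simp: prob_space c_def\<close>)
  then have "AE x in M. \<forall>j. \<exists>C. \<forall>n. birkhoff_sum T (\<lambda>x. f x - c j) n x \<le> C"
    by (simp add: AE_all_countable)
  then show ?thesis
  proof eventually_elim
    case (elim x)
    show ?case
    proof (intro allI impI)
      fix e :: real assume "e > 0"
      then obtain j where j: "inverse (real (Suc j)) < e / 2"
        using reals_Archimedean[of "e/2"] by auto
      obtain C where C: "\<And>n. birkhoff_sum T (\<lambda>x. f x - c j) n x \<le> C" using elim by blast
      have "birkhoff_sum T (\<lambda>x. f x - c j) n x = birkhoff_sum T f n x - n * c j" for n
        by (simp add: birkhoff_sum_def sum_subtractf)
      then have bd: "birkhoff_sum T f n x \<le> C + n * c j" for n using C[of n] by simp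
      have "(\<lambda>n. C / real n) \<longlonglongrightarrow> 0" by real_asymp
      then have "\<forall>\<^sub>F n in sequentially. C / real n < e / 2"
        using \<open>e > 0\<close> by (intro order_tendstoD) auto
      then show "\<forall>\<^sub>F n in sequentially. birkhoff_sum T f n x / n < (\<integral>x. f x \<partial>M) + e"
        using eventually_gt_at_top[of 0]
      proof eventually_elim
        case (elim n)
        have "birkhoff_sum T f n x / n \<le> C / n + c j"
          using bd[of n] elim by (simp add: field_simps)
        then show ?case using elim(1) j unfolding c_def by linarith
      qed
    qed
  qed
qed

theorem birkhoff_ergodic:
  assumes erg: "ergodic_map M T" and f: "integrable M f"
  shows "AE x in M. (\<lambda>n. birkhoff_sum T f n x / n) \<longlonglongrightarrow> (\<integral>x. f x \<partial>M)"
  using birkhoff_upper[OF erg f] birkhoff_upper[OF erg integrable_minus[OF f]]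
proof eventually_elim
  case (elim x)
  have m: "birkhoff_sum T (\<lambda>x. - f x) n x = - birkhoff_sum T f n x" for n
    by (simp add: birkhoff_sum_def sum_negf)
  show ?case
  proof (rule tendstoI)
    fix e :: real assume "e > 0"
    with elim have "\<forall>\<^sub>F n in sequentially. birkhoff_sum T f n x / n < (\<integral>x. f x \<partial>M) + e"
      "\<forall>\<^sub>F n in sequentially. birkhoff_sum T (\<lambda>x. - f x) n x / n < (\<integral>x. - f x \<partial>M) + e" by blast+
    then show "\<forall>\<^sub>F n in sequentially. dist (birkhoff_sum T f n x / n) (\<integral>x. f x \<partial>M) < e"
      by eventually_elim (simp add: m dist_real_def abs_less_iff)
  qed
qed

section \<open>Geometric weights and corner flips\<close>

text \<open>
  The parameter is the one of the tails \<open>r\<^sup>k\<close>, for which products of parameters are meaningful.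
\<close>
definition geom :: "real \<Rightarrow> nat pmf" where "geom r = geometric_pmf (1 - r)"

lemma pmf_geom:
  assumes "0 \<le> r" "r < 1" shows "pmf (geom r) n = r ^ n * (1 - r)"
  using assms by (simp add: geom_def)

text \<open>
  The local rule of last-passage percolation.  If \<open>I\<close> and \<open>J\<close> are the increments of the passage time
  along the lower and the left edge of a unit square and \<open>W\<close> is the weight at its upper right corner,
  then the increments along the upper and the right edge are \<open>W + (I - J)\<^sup>+\<close> and \<open>W + (J - I)\<^sup>+\<close>.
  Truncated subtraction supplies the positive parts.  Recording also \<open>min I J\<close> makes the rule an
  involution, and reusing the three slots of the input makes it act on one fixed space.
\<close>
definition corner_flip :: "'i \<Rightarrow> 'i \<Rightarrow> 'i \<Rightarrow> ('i \<Rightarrow> nat) \<Rightarrow> ('i \<Rightarrow> nat)" where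
  "corner_flip x y c w = w(x := w c + (w x - w y), y := w c + (w y - w x), c := min (w x) (w y))"

lemma corner_flip_involution:
  assumes "x \<noteq> y" "x \<noteq> c" "y \<noteq> c"
  shows "corner_flip x y c (corner_flip x y c w) = w"
  using assms by (auto simp: corner_flip_def fun_eq_iff min_def)

lemma map_pmf_involution:
  assumes inv: "\<And>x. f (f x) = x" and eq: "\<And>x. pmf p (f x) = pmf p x"
  shows "map_pmf f p = p"
proof (rule pmf_eqI)
  fix x
  have "inj f" by (rule inj_on_inverseI) (rule inv)
  have "pmf (map_pmf f p) x = pmf (map_pmf f p) (f (f x))" by (simp add: inv)
  also have "\<dots> = pmf p x" using \<open>inj f\<close> by (simp only: pmf_map_inj' eq)
  finally show "pmf (map_pmf f p) x = pmf p x" .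
qed

text \<open>
  The local Burke property.  With parameters \<open>r\<close>, \<open>s\<close> and \<open>r * s\<close> the joint mass function of
  \<open>(I, J, W)\<close> is a constant times \<open>r\<^bsup>I+W\<^esup> * s\<^bsup>J+W\<^esup>\<close>, and both exponents are preserved by the
  flip.  A bijection that preserves the mass function preserves the law.
\<close>
lemma Pi_pmf_corner_flip:
  assumes A: "finite A" "x \<in> A" "y \<in> A" "c \<in> A" and ne: "x \<noteq> y" "x \<noteq> c" "y \<noteq> c"
    and p: "p x = geom r" "p y = geom s" "p c = geom (r * s)"
    and r: "0 \<le> r" "r < 1" and s: "0 \<le> s" "s < 1"
  shows "map_pmf (corner_flip x y c) (Pi_pmf A d p) = Pi_pmf A d p"
proof (rule map_pmf_involution)
  show "corner_flip x y c (corner_flip x y c w) = w" for w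
    by (rule corner_flip_involution[OF ne])
  fix w :: "'a \<Rightarrow> nat"
  let ?w = "corner_flip x y c w"
  have rs: "0 \<le> r * s" "r * s < 1"
    using r s mult_strict_mono'[of r 1 s 1] by auto
  let ?D = "{x, y, c}"
  have split: "(\<Prod>i\<in>A. pmf (p i) (v i)) =
      pmf (p x) (v x) * pmf (p y) (v y) * pmf (p c) (v c) * (\<Prod>i\<in>A - ?D. pmf (p i) (v i))" for v
    using A ne by (subst prod.subset_diff[of ?D]) auto
  have "r ^ (w c + (w x - w y)) * s ^ (w c + (w y - w x)) * (r * s) ^ min (w x) (w y) =
      r ^ w x * s ^ w y * (r * s) ^ w c"
  proof (cases "w x \<le> w y")
    case True
    then obtain k where "w y = w x + k" using le_Suc_ex by blast
    then show ?thesis by (simp add: power_add power_mult_distrib mult_ac)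
  next
    case False
    then obtain k where "w x = w y + k" using le_Suc_ex[of "w y" "w x"] by auto
    then show ?thesis by (simp add: power_add power_mult_distrib mult_ac)
  qed
  then have "pmf (p x) (?w x) * pmf (p y) (?w y) * pmf (p c) (?w c) =
      pmf (p x) (w x) * pmf (p y) (w y) * pmf (p c) (w c)"
    using ne by (simp add: p pmf_geom r s rs corner_flip_def)
  moreover have "(\<Prod>i\<in>A - ?D. pmf (p i) (?w i)) = (\<Prod>i\<in>A - ?D. pmf (p i) (w i))"
    by (intro prod.cong) (auto simp: corner_flip_def)
  moreover have "(\<forall>i. i \<notin> A \<longrightarrow> ?w i = d) \<longleftrightarrow> (\<forall>i. i \<notin> A \<longrightarrow> w i = d)"
    using A by (auto simp: corner_flip_def)
  ultimately show "pmf (Pi_pmf A d p) ?w = pmf (Pi_pmf A d p) w"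
    by (simp only: pmf_Pi[OF A(1)] split)
qed

text \<open>
  The third output of a corner flip has the law of its third input.
\<close>
lemma min_geom:
  assumes r: "0 \<le> r" "r < 1" and s: "0 \<le> s" "s < 1"
  shows "map_pmf (\<lambda>(u, v). min u v) (pair_pmf (geom r) (geom s)) = geom (r * s)"
proof -
  define p where "p = (\<lambda>i::nat. if i = 0 then geom r else if i = 1 then geom s else geom (r * s))"
  let ?P = "Pi_pmf {0, 1, 2::nat} 0 p"
  have pair: "pair_pmf (geom r) (geom s) = map_pmf (\<lambda>w. (w 0, w 1)) ?P"
  proof -
    have "?P = map_pmf (\<lambda>(y, f). f(0 := y)) (pair_pmf (p 0) (Pi_pmf {1, 2} 0 p))"
      by (subst Pi_pmf_insert) auto
    then have "map_pmf (\<lambda>w. (w 0, w 1)) ?P = map_pmf (apsnd (\<lambda>f. f 1)) (pair_pmf (p 0) (Pi_pmf {1, 2} 0 p))"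
      by (simp only: map_pmf_comp) (auto intro!: map_pmf_cong)
    also have "\<dots> = pair_pmf (p 0) (map_pmf (\<lambda>f. f 1) (Pi_pmf {1, 2} 0 p))"
      by (rule pair_map_pmf2[symmetric])
    also have "map_pmf (\<lambda>f. f 1) (Pi_pmf {1, 2} 0 p) = p 1"
      by (subst Pi_pmf_component) auto
    finally show ?thesis by (simp add: p_def)
  qed
  have "map_pmf (\<lambda>(u, v). min u v) (pair_pmf (geom r) (geom s)) = map_pmf (\<lambda>w. w 2) (map_pmf (corner_flip 0 1 2) ?P)"
    unfolding pair map_pmf_comp by (auto simp: corner_flip_def intro!: map_pmf_cong)
  also have "map_pmf (corner_flip 0 1 2) ?P = ?P"
    by (rule Pi_pmf_corner_flip[where r = r and s = s]) (use assms in \<open>auto simp: p_def\<close>)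
  also have "map_pmf (\<lambda>w. w 2) ?P = geom (r * s)"
    by (subst Pi_pmf_component) (auto simp: p_def)
  finally show ?thesis .
qed

lemma geom_monotone_coupling:
  assumes "0 < r" "r < r'" "r' < 1"
  obtains c :: "(nat \<times> nat) pmf" where "map_pmf fst c = geom r" "map_pmf snd c = geom r'"
    "\<And>u v. (u, v) \<in> set_pmf c \<Longrightarrow> u \<le> v"
proof -
  \<comment> \<open>The minimum with an independent variable of parameter \<open>r / r'\<close> lowers the parameter \<open>r'\<close> to \<open>r\<close>.\<close>
  define c where "c = map_pmf (\<lambda>(u, v). (min u v, u)) (pair_pmf (geom r') (geom (r / r')))"
  have "r / r' < 1" using assms by simp
  then have "map_pmf fst c = geom (r' * (r / r'))"
    using assms min_geom[of r' "r / r'"] by (simp add: c_def map_pmf_comp case_prod_unfold)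
  then have "map_pmf fst c = geom r" using assms by simp
  moreover have "map_pmf snd c = geom r'"
    by (simp add: c_def map_pmf_comp case_prod_beta map_fst_pair_pmf)
  moreover have "u \<le> v" if "(u, v) \<in> set_pmf c" for u v using that by (auto simp: c_def)
  ultimately show ?thesis using that by blast
qed

section \<open>Deviations of sums of geometric weights\<close>

text \<open>
  With \<open>\<rho> = sqrt r\<close> the summand is the square of \<open>n * \<rho>\<^sup>n\<close>, which is eventually below \<open>n * \<rho>\<^sup>n\<close> itself.
\<close>
lemma summable_square_geometric:
  fixes r :: real
  assumes "0 \<le> r" "r < 1" shows "summable (\<lambda>n. (real n)\<^sup>2 * r ^ n)"
proof -
  let ?s = "sqrt r"
  have s: "0 \<le> ?s" "?s < 1" using assms by auto
  have "(\<lambda>n. real n * ?s ^ n) \<longlonglongrightarrow> 0" using s by (intro powser_times_n_limit_0) auto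
  then have "\<forall>\<^sub>F n in sequentially. real n * ?s ^ n < 1" by (rule order_tendstoD) simp
  then have "\<forall>\<^sub>F n in sequentially. norm ((real n)\<^sup>2 * r ^ n) \<le> ?s ^ n * real n"
  proof eventually_elim
    case (elim n)
    have "r ^ n = ?s ^ n * ?s ^ n" using assms by (simp add: power_mult_distrib[symmetric])
    then have "norm ((real n)\<^sup>2 * r ^ n) = (real n * ?s ^ n) * (real n * ?s ^ n)"
      using s by (simp add: power2_eq_square abs_mult)
    also have "\<dots> \<le> 1 * (real n * ?s ^ n)" using elim s by (intro mult_right_mono) auto
    finally show ?case by (simp add: mult.commute)
  qed
  moreover have "summable (\<lambda>n. ?s ^ n * real n)"
    using geometric_sums_times_n[of ?s] s by (auto simp: sums_iff)
  ultimately show ?thesis by (rule summable_comparison_test_ev)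
qed

text \<open>
  A majorant of the second moments of all geometric laws with parameter at most \<open>r0\<close>, obtained by
  replacing the mass \<open>r\<^sup>n * (1 - r)\<close> with \<open>r0\<^sup>n\<close>.
\<close>
definition geom_second_moment_bound :: "real \<Rightarrow> real" where
  "geom_second_moment_bound r0 = (\<Sum>n. (real n)\<^sup>2 * r0 ^ n)"

lemma geom_second_moment:
  assumes "0 \<le> r" "r \<le> r0" "r0 < 1"
  shows "integrable (geom r) (\<lambda>n. (real n)\<^sup>2)"
    and "measure_pmf.expectation (geom r) (\<lambda>n. (real n)\<^sup>2) \<le> geom_second_moment_bound r0"
proof -
  have sm: "summable (\<lambda>n. (real n)\<^sup>2 * r0 ^ n)" by (rule summable_square_geometric) (use assms in auto)
  have le: "pmf (geom r) n * (real n)\<^sup>2 \<le> (real n)\<^sup>2 * r0 ^ n" for n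
  proof -
    have "r ^ n * (1 - r) \<le> r0 ^ n * 1" using assms by (intro mult_mono power_mono) auto
    then have "r ^ n * (1 - r) * (real n)\<^sup>2 \<le> r0 ^ n * (real n)\<^sup>2" by (intro mult_right_mono) auto
    then show ?thesis using assms by (simp add: pmf_geom mult_ac)
  qed
  have sm': "summable (\<lambda>n. pmf (geom r) n * (real n)\<^sup>2)"
    by (rule summable_comparison_test[OF _ sm]) (use le in \<open>auto simp: abs_mult\<close>)
  have i: "integrable (count_space UNIV) (\<lambda>n. pmf (geom r) n * (real n)\<^sup>2)"
    using sm' by (simp add: integrable_count_space_nat_iff abs_mult)
  then show "integrable (geom r) (\<lambda>n. (real n)\<^sup>2)"
    unfolding measure_pmf_eq_density by (subst integrable_density) auto
  have "measure_pmf.expectation (geom r) (\<lambda>n. (real n)\<^sup>2) = (\<Sum>n. pmf (geom r) n * (real n)\<^sup>2)"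
    unfolding measure_pmf_eq_density using i
    by (subst integral_density) (auto simp: integral_count_space_nat)
  also have "\<dots> \<le> geom_second_moment_bound r0"
    unfolding geom_second_moment_bound_def by (intro suminf_le le sm sm')
  finally show "measure_pmf.expectation (geom r) (\<lambda>n. (real n)\<^sup>2) \<le> geom_second_moment_bound r0" .
qed

lemma expectation_geom:
  assumes "0 \<le> r" "r < 1"
  shows "integrable (geom r) real" "measure_pmf.expectation (geom r) real = r / (1 - r)"
  using integrable_real_geometric_pmf[of "1 - r"] expectation_geometric_pmf[of "1 - r"] assms
  by (auto simp: geom_def)

lemma (in prob_space) expectation_square_sum_indep:
  fixes X :: "'i \<Rightarrow> 'a \<Rightarrow> real"
  assumes fin: "finite I" and ind: "indep_vars (\<lambda>_. borel) X I"
    and int: "\<And>i. i \<in> I \<Longrightarrow> integrable M (X i)" "\<And>i. i \<in> I \<Longrightarrow> integrable M (\<lambda>w. (X i w)\<^sup>2)"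
    and zero: "\<And>i. i \<in> I \<Longrightarrow> expectation (X i) = 0"
  shows "integrable M (\<lambda>w. (\<Sum>i\<in>I. X i w)\<^sup>2)"
    and "expectation (\<lambda>w. (\<Sum>i\<in>I. X i w)\<^sup>2) = (\<Sum>i\<in>I. expectation (\<lambda>w. (X i w)\<^sup>2))"
proof -
  have prod: "integrable M (\<lambda>w. X i w * X j w) \<and>
      expectation (\<lambda>w. X i w * X j w) = (if i = j then expectation (\<lambda>w. (X i w)\<^sup>2) else 0)"
    if "i \<in> I" "j \<in> I" for i j
  proof (cases "i = j")
    case True
    then show ?thesis using int(2)[OF that(1)] by (simp add: power2_eq_square)
  next
    case False
    then have "indep_var borel (X i) borel (X j)"
      using indep_vars_sum[of "{j}" i X] indep_vars_subset[OF ind, of "{i, j}"] that by simp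
    with False show ?thesis
      using int(1) zero that by (auto simp: indep_var_lebesgue_integral indep_var_integrable)
  qed
  have eq: "(\<lambda>w. (\<Sum>i\<in>I. X i w)\<^sup>2) = (\<lambda>w. \<Sum>i\<in>I. \<Sum>j\<in>I. X i w * X j w)"
    by (simp add: power2_eq_square sum_product)
  show "integrable M (\<lambda>w. (\<Sum>i\<in>I. X i w)\<^sup>2)"
    unfolding eq using prod by (intro Bochner_Integration.integrable_sum) auto
  have "expectation (\<lambda>w. (\<Sum>i\<in>I. X i w)\<^sup>2) = (\<Sum>i\<in>I. \<Sum>j\<in>I. expectation (\<lambda>w. X i w * X j w))"
    unfolding eq using prod
    by (subst Bochner_Integration.integral_sum Bochner_Integration.integrable_sum | auto)+
  also have "\<dots> = (\<Sum>i\<in>I. expectation (\<lambda>w. (X i w)\<^sup>2))"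
    using prod fin by (intro sum.cong) (auto simp: sum.delta)
  finally show "expectation (\<lambda>w. (\<Sum>i\<in>I. X i w)\<^sup>2) = (\<Sum>i\<in>I. expectation (\<lambda>w. (X i w)\<^sup>2))" .
qed

text \<open>
  Chebyshev's inequality.  The variances are bounded by the second moments, uniformly in the parameters.
\<close>
lemma geometric_sum_deviation:
  fixes I A :: "'i set" and r :: "'i \<Rightarrow> real"
  assumes A: "finite A" "I \<subseteq> A"
    and r: "\<And>i. i \<in> I \<Longrightarrow> 0 \<le> r i" "\<And>i. i \<in> I \<Longrightarrow> r i \<le> r0" "r0 < 1"
    and p: "\<And>i. i \<in> I \<Longrightarrow> p i = geom (r i)" and c: "c > 0"
  shows "measure_pmf.prob (Pi_pmf A 0 p) {w. c \<le> \<bar>(\<Sum>i\<in>I. real (w i)) - (\<Sum>i\<in>I. r i / (1 - r i))\<bar>}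
    \<le> card I * geom_second_moment_bound r0 / c\<^sup>2"
proof -
  let ?P = "Pi_pmf A 0 p"
  have I: "finite I" using A finite_subset by blast
  define X where "X i w = real (w i) - r i / (1 - r i)" for i and w :: "'i \<Rightarrow> nat"
  have marg: "geom (r i) = map_pmf (\<lambda>w. w i) ?P" if "i \<in> I" for i
    using that A p by (subst Pi_pmf_component) auto
  have i1: "integrable ?P (\<lambda>w. real (w i))" and e1: "measure_pmf.expectation ?P (\<lambda>w. real (w i)) = r i / (1 - r i)"
    if "i \<in> I" for i
  proof -
    have "0 \<le> r i" "r i < 1" using r(1,2)[of i] that r(3) by auto
    from expectation_geom[OF this] show "integrable ?P (\<lambda>w. real (w i))"
      "measure_pmf.expectation ?P (\<lambda>w. real (w i)) = r i / (1 - r i)"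
      unfolding marg[OF that] by simp_all
  qed
  have i2: "integrable ?P (\<lambda>w. (real (w i))\<^sup>2)"
    and e2: "measure_pmf.expectation ?P (\<lambda>w. (real (w i))\<^sup>2) \<le> geom_second_moment_bound r0"
    if "i \<in> I" for i
  proof -
    from geom_second_moment[OF r(1)[OF that] r(2)[OF that] r(3)]
    show "integrable ?P (\<lambda>w. (real (w i))\<^sup>2)"
      "measure_pmf.expectation ?P (\<lambda>w. (real (w i))\<^sup>2) \<le> geom_second_moment_bound r0"
      unfolding marg[OF that] by simp_all
  qed
  have X1: "integrable ?P (X i)" "measure_pmf.expectation ?P (X i) = 0" if "i \<in> I" for i
    using i1[OF that] e1[OF that] by (auto simp: X_def[abs_def])
  have X2: "integrable ?P (\<lambda>w. (X i w)\<^sup>2)" if "i \<in> I" for i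
    using i1[OF that] i2[OF that] by (auto simp: X_def[abs_def] power2_diff)
  have X3: "measure_pmf.expectation ?P (\<lambda>w. (X i w)\<^sup>2) \<le> geom_second_moment_bound r0" if "i \<in> I" for i
  proof -
    have "measure_pmf.expectation ?P (\<lambda>w. (X i w)\<^sup>2) =
        measure_pmf.expectation ?P (\<lambda>w. (real (w i))\<^sup>2) - (r i / (1 - r i))\<^sup>2"
      using measure_pmf.variance_eq[OF i1[OF that] i2[OF that]] e1[OF that] by (simp add: X_def)
    then show ?thesis using e2[OF that] by (smt (verit) zero_le_power2)
  qed
  have ind: "prob_space.indep_vars ?P (\<lambda>_. borel) X I"
  proof -
    have "prob_space.indep_vars ?P (\<lambda>_. count_space UNIV) (\<lambda>x f. f x) I"
      using prob_space.indep_vars_subset[OF measure_pmf.prob_space_axioms indep_vars_Pi_pmf[OF A(1)] A(2)] .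
    then show ?thesis
      unfolding X_def[abs_def] by (rule prob_space.indep_vars_compose2[OF measure_pmf.prob_space_axioms]) auto
  qed
  note S = prob_space.expectation_square_sum_indep[OF measure_pmf.prob_space_axioms I ind X1(1) X2 X1(2)]
  have "measure_pmf.prob ?P {w \<in> space ?P. c\<^sup>2 \<le> (\<Sum>i\<in>I. X i w)\<^sup>2} \<le> measure_pmf.expectation ?P (\<lambda>w. (\<Sum>i\<in>I. X i w)\<^sup>2) / c\<^sup>2"
    using c by (intro integral_Markov_inequality_measure[where A = "{}"] S) auto
  also have "\<dots> \<le> card I * geom_second_moment_bound r0 / c\<^sup>2"
    using S(2) sum_bounded_above[of I _ "geom_second_moment_bound r0", OF X3]
    by (intro divide_right_mono) auto
  also have "{w \<in> space ?P. c\<^sup>2 \<le> (\<Sum>i\<in>I. X i w)\<^sup>2} =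
      {w. c \<le> \<bar>(\<Sum>i\<in>I. real (w i)) - (\<Sum>i\<in>I. r i / (1 - r i))\<bar>}"
    using c by (auto simp: X_def sum_subtractf abs_le_square_iff[symmetric])
  finally show ?thesis .
qed

section \<open>Last-passage times with boundary weights\<close>

text \<open>
  Fields on the quadrant carry boundary weights in row and column \<open>0\<close>; the bulk consists of the
  remaining sites, renumbered from \<open>0\<close>.
\<close>
definition bulk :: "(nat \<times> nat \<Rightarrow> 'a) \<Rightarrow> (nat \<times> nat \<Rightarrow> 'a)" where
  "bulk W = (\<lambda>(i, j). W (Suc i, Suc j))"

definition row_sum :: "(nat \<times> nat \<Rightarrow> real) \<Rightarrow> nat \<Rightarrow> real" where
  "row_sum W k = (\<Sum>i<k. W (Suc i, 0))"

definition col_sum :: "(nat \<times> nat \<Rightarrow> real) \<Rightarrow> nat \<Rightarrow> real" where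
  "col_sum W k = (\<Sum>j<k. W (0, Suc j))"

definition boundary_field :: "(nat \<times> nat \<Rightarrow> real) \<Rightarrow> bool" where
  "boundary_field W \<longleftrightarrow> (\<forall>x. 0 \<le> W x) \<and> W (0, 0) = 0"

lemma last_passage_right_0 [simp]: "last_passage W i 0 = 0"
  by (cases i) auto

lemma last_passage_nonneg:
  assumes "\<And>x. 0 \<le> W x" shows "0 \<le> last_passage W i j"
  using assms by (induction W i j rule: last_passage.induct) (auto simp: max_def)

lemma boundary_field_passage_nonneg:
  assumes "boundary_field W" shows "0 \<le> last_passage W i j" "0 \<le> W x" "W (0, 0) = 0"
  using assms last_passage_nonneg[of W i j] by (simp_all only: boundary_field_def)

lemma last_passage_row:
  assumes "boundary_field W" shows "last_passage W (Suc i) (Suc 0) = row_sum W i"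
proof (induction i)
  case (Suc i)
  moreover have "0 \<le> row_sum W i"
    using assms by (auto simp: row_sum_def boundary_field_def intro: sum_nonneg)
  ultimately show ?case by (simp add: row_sum_def)
qed (use boundary_field_passage_nonneg[OF assms] in \<open>simp add: row_sum_def\<close>)

lemma last_passage_col:
  assumes "boundary_field W" shows "last_passage W (Suc 0) (Suc j) = col_sum W j"
proof (induction j)
  case (Suc j)
  moreover have "0 \<le> col_sum W j"
    using assms by (auto simp: col_sum_def boundary_field_def intro: sum_nonneg)
  ultimately show ?case by (simp add: col_sum_def)
qed (use boundary_field_passage_nonneg[OF assms] in \<open>simp add: col_sum_def\<close>)

lemma last_passage_bulk_le:
  assumes "boundary_field W"
  shows "last_passage (bulk W) i j \<le> last_passage W (Suc i) (Suc j)"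
proof (induction i arbitrary: j)
  case 0
  show ?case unfolding last_passage.simps(1) by (rule boundary_field_passage_nonneg[OF assms])
next
  case (Suc i)
  note outer = Suc
  show ?case
  proof (induction j)
    case 0
    show ?case unfolding last_passage_right_0 by (rule boundary_field_passage_nonneg[OF assms])
  next
    case (Suc j)
    have step: "last_passage (bulk W) (Suc i) (Suc j) =
        max (last_passage (bulk W) i (Suc j)) (last_passage (bulk W) (Suc i) j) + W (Suc i, Suc j)"
      by (simp add: bulk_def)
    show ?case
      unfolding step last_passage.simps(3)[of W "Suc i" "Suc j"]
      by (rule add_right_mono, rule max.mono[OF outer Suc.IH])
  qed
qed

lemma last_passage_cong:
  assumes "\<And>x y. x < i \<Longrightarrow> y < j \<Longrightarrow> W (x, y) = W' (x, y)"
  shows "last_passage W i j = last_passage W' i j"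
  using assms
proof (induction W i j rule: last_passage.induct)
  case (3 W i j)
  have "last_passage W i (Suc j) = last_passage W' i (Suc j)"
    by (rule 3(1)) (use 3(3) in auto)
  moreover have "last_passage W (Suc i) j = last_passage W' (Suc i) j"
    by (rule 3(2)) (use 3(3) in auto)
  ultimately show ?case using 3(3)[of i j] by simp
qed simp_all

lemma le_max_max:
  fixes x :: real
  assumes "x \<le> a \<or> x \<le> b \<or> x \<le> c \<or> x \<le> d"
  shows "x \<le> max (max a b) (max c d)"
  using assms by (simp only: le_max_iff_disj) blast

text \<open>
  If four candidates dominate a passage time at the two predecessors of a site, and each candidate
  satisfies the last-passage recursion as an inequality, then they dominate it at the site.
\<close>
lemma max_add_mono_split:
  fixes u v w :: real
  assumes u: "u \<le> max (max a b) (max c d)" and v: "v \<le> max (max a' b') (max c' d')"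
    and le: "max a a' + w \<le> a''" "max b b' + w \<le> b''" "max c c' + w \<le> c''" "max d d' + w \<le> d''"
  shows "max u v + w \<le> max (max a'' b'') (max c'' d'')"
proof -
  have le': "a + w \<le> a''" "b + w \<le> b''" "c + w \<le> c''" "d + w \<le> d''"
    "a' + w \<le> a''" "b' + w \<le> b''" "c' + w \<le> c''" "d' + w \<le> d''"
    using le by (simp_all add: max_add_distrib_left)
  have "u + w \<le> max (max a'' b'') (max c'' d'')"
    using u le' unfolding le_max_iff_disj by auto
  moreover have "v + w \<le> max (max a'' b'') (max c'' d'')"
    using v le' unfolding le_max_iff_disj by auto
  ultimately show ?thesis by (simp add: max_add_distrib_left)
qed

text \<open>
  A maximizing path leaves the axes either early, within distance \<open>k\<close> or \<open>h\<close> of the origin, or late.  If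
  early, it collects at most a short boundary sum plus the passage time of the bulk.  If it leaves the
  horizontal axis late, it collects at least \<open>row_sum W' k - row_sum W k\<close> more in the field \<open>W'\<close>, whose
  horizontal weights are larger; similarly for the vertical axis and \<open>W''\<close>.  Exit points need not be
  mentioned in the proof: each of the four alternatives dominates the boundary values and satisfies
  the last-passage recursion as an inequality.
\<close>
lemma last_passage_exit_split:
  assumes W: "boundary_field W" "boundary_field W'" "boundary_field W''"
    and bulk: "\<And>i j. W' (Suc i, Suc j) = W (Suc i, Suc j)" "\<And>i j. W'' (Suc i, Suc j) = W (Suc i, Suc j)"
    and row: "\<And>i. W (Suc i, 0) \<le> W' (Suc i, 0)" and col: "\<And>j. W (0, Suc j) \<le> W'' (0, Suc j)"
  shows "last_passage W (Suc i) (Suc j) \<le>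
    max (max (row_sum W k + last_passage (bulk W) i j) (col_sum W h + last_passage (bulk W) i j))
        (max (last_passage W' (Suc i) (Suc j) - (row_sum W' k - row_sum W k))
             (last_passage W'' (Suc i) (Suc j) - (col_sum W'' h - col_sum W h)))"
    (is "_ \<le> ?R i j")
proof -
  have row_diff: "row_sum W' k - row_sum W k \<le> row_sum W' i - row_sum W i" if "k \<le> i" for i k
    unfolding row_sum_def sum_subtractf[symmetric]
    by (rule sum_mono2) (use that row in auto)
  have row_mono: "row_sum W i \<le> row_sum W k" if "i \<le> k" for i k
    unfolding row_sum_def by (rule sum_mono2) (use that W in \<open>auto simp: boundary_field_def\<close>)
  have col_diff: "col_sum W'' k - col_sum W k \<le> col_sum W'' i - col_sum W i" if "k \<le> i" for i k
    unfolding col_sum_def sum_subtractf[symmetric]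
    by (rule sum_mono2) (use that col in auto)
  have col_mono: "col_sum W i \<le> col_sum W k" if "i \<le> k" for i k
    unfolding col_sum_def by (rule sum_mono2) (use that W in \<open>auto simp: boundary_field_def\<close>)
  have row0: "last_passage W (Suc i) (Suc 0) \<le> ?R i 0" for i
    unfolding last_passage_row[OF W(1)] last_passage_row[OF W(2)] last_passage_right_0
    using row_diff[of k i] row_mono[of i k] by (cases "k \<le> i") (auto intro!: le_max_max)
  have col0: "last_passage W (Suc 0) (Suc j) \<le> ?R 0 j" for j
    unfolding last_passage_col[OF W(1)] last_passage_col[OF W(3)] last_passage.simps(1)
    using col_diff[of h j] col_mono[of j h] by (cases "h \<le> j") (auto intro!: le_max_max)
  show ?thesis
  proof (induction i arbitrary: j)
    case 0
    show ?case by (rule col0)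
  next
    case (Suc i)
    note outer = Suc
    show ?case
    proof (induction j)
      case 0
      show ?case by (rule row0)
    next
      case (Suc j)
      have step: "last_passage V (Suc (Suc i)) (Suc (Suc j)) =
          max (last_passage V (Suc i) (Suc (Suc j))) (last_passage V (Suc (Suc i)) (Suc j)) + V (Suc i, Suc j)" for V
        by (rule last_passage.simps(3))
      have bstep: "last_passage (bulk W) (Suc i) (Suc j) =
          max (last_passage (bulk W) i (Suc j)) (last_passage (bulk W) (Suc i) j) + W (Suc i, Suc j)"
        by (simp add: bulk_def)
      show ?case
        unfolding step[of W]
        by (rule max_add_mono_split[OF outer[of "Suc j"] Suc.IH])
           (unfold step[of W'] step[of W''] bstep bulk, simp_all only: max_diff_distrib_left max_add_distrib_left max_add_distrib_right max.bounded_iff, auto simp: max_def)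
    qed
  qed
qed

abbreviation real_field :: "(nat \<times> nat \<Rightarrow> nat) \<Rightarrow> (nat \<times> nat \<Rightarrow> real)" where
  "real_field w \<equiv> \<lambda>x. real (w x)"

section \<open>The stationary model\<close>

text \<open>
  A sweep reads the passage times of a field off its weights by corner flips alone.  In column \<open>i\<close>, after
  \<open>j\<close> flips, slot \<open>(i, 0)\<close> holds the horizontal increment into column \<open>i\<close> at height \<open>j\<close>, and the slots
  \<open>(0, 1), \<dots>, (0, j)\<close> hold the vertical increments in column \<open>i\<close>, while the higher ones still hold those
  of column \<open>i - 1\<close>.
\<close>
primrec sweep_column :: "nat \<Rightarrow> nat \<Rightarrow> (nat \<times> nat \<Rightarrow> nat) \<Rightarrow> (nat \<times> nat \<Rightarrow> nat)" where
  "sweep_column i 0 w = w"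
| "sweep_column i (Suc j) w = corner_flip (i, 0) (0, Suc j) (i, Suc j) (sweep_column i j w)"

primrec sweep_columns :: "nat \<Rightarrow> nat \<Rightarrow> (nat \<times> nat \<Rightarrow> nat) \<Rightarrow> (nat \<times> nat \<Rightarrow> nat)" where
  "sweep_columns n 0 w = w"
| "sweep_columns n (Suc m) w = sweep_column (Suc m) n (sweep_columns n m w)"

text \<open>
  Here \<open>H\<close> and \<open>K\<close> are the passage times in columns \<open>i - 1\<close> and \<open>i\<close>.
\<close>
lemma sweep_column_increments:
  fixes H K :: "nat \<Rightarrow> real"
  assumes i: "0 < i"
    and K0: "K 0 = H 0 + w (i, 0)"
    and K: "\<And>j. K (Suc j) = max (H (Suc j)) (K j) + w (i, Suc j)"
    and H: "\<And>j. j < n \<Longrightarrow> H (Suc j) - H j = w (0, Suc j)"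
    and "j \<le> n"
  shows "real (sweep_column i j w (i, 0)) = K j - H j"
    "\<And>k. k < j \<Longrightarrow> real (sweep_column i j w (0, Suc k)) = K (Suc k) - K k"
    "\<And>k. j \<le> k \<Longrightarrow> sweep_column i j w (0, Suc k) = w (0, Suc k)"
    "\<And>k. j < k \<Longrightarrow> sweep_column i j w (i, k) = w (i, k)"
    "\<And>x y. x \<noteq> i \<Longrightarrow> 0 < x \<Longrightarrow> sweep_column i j w (x, y) = w (x, y)"
proof -
  let ?P = "\<lambda>j. real (sweep_column i j w (i, 0)) = K j - H j \<and>
    (\<forall>k<j. real (sweep_column i j w (0, Suc k)) = K (Suc k) - K k) \<and>
    (\<forall>k\<ge>j. sweep_column i j w (0, Suc k) = w (0, Suc k)) \<and>
    (\<forall>k>j. sweep_column i j w (i, k) = w (i, k)) \<and>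
    (\<forall>x y. x \<noteq> i \<longrightarrow> 0 < x \<longrightarrow> sweep_column i j w (x, y) = w (x, y))"
  have "?P j" using \<open>j \<le> n\<close>
  proof (induction j)
    case 0
    show ?case using K0 by simp
  next
    case (Suc j)
    let ?v = "sweep_column i j w"
    have IH: "?P j" using Suc by simp
    have I: "real (?v (i, 0)) = K j - H j" and J: "real (?v (0, Suc j)) = H (Suc j) - H j"
      and W: "?v (i, Suc j) = w (i, Suc j)"
      using IH H[of j] Suc.prems by auto
    have "real (?v (i, Suc j) + (?v (i, 0) - ?v (0, Suc j))) = K (Suc j) - H (Suc j)"
      using I J W K[of j] by (cases "?v (i, 0) \<le> ?v (0, Suc j)") (auto simp: of_nat_diff)
    moreover have "real (?v (i, Suc j) + (?v (0, Suc j) - ?v (i, 0))) = K (Suc j) - K j"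
      using I J W K[of j] by (cases "?v (i, 0) \<le> ?v (0, Suc j)") (auto simp: of_nat_diff)
    moreover have "sweep_column i (Suc j) w = ?v((i, 0) := ?v (i, Suc j) + (?v (i, 0) - ?v (0, Suc j)),
        (0, Suc j) := ?v (i, Suc j) + (?v (0, Suc j) - ?v (i, 0)),
        (i, Suc j) := min (?v (i, 0)) (?v (0, Suc j)))"
      by (simp add: corner_flip_def)
    ultimately have new: "real (sweep_column i (Suc j) w (i, 0)) = K (Suc j) - H (Suc j)"
      "real (sweep_column i (Suc j) w (0, Suc j)) = K (Suc j) - K j"
      and old: "\<And>x. x \<noteq> (i, 0) \<Longrightarrow> x \<noteq> (0, Suc j) \<Longrightarrow> x \<noteq> (i, Suc j) \<Longrightarrow>
        sweep_column i (Suc j) w x = ?v x"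
      using i by (simp_all del: sweep_column.simps)
    show ?case
    proof (intro conjI allI impI)
      show "real (sweep_column i (Suc j) w (0, Suc k)) = K (Suc k) - K k" if "k < Suc j" for k
        using that new(2) old[of "(0, Suc k)"] IH i by (cases "k = j") (simp_all del: sweep_column.simps)
    qed (use new old IH i in \<open>simp_all del: sweep_column.simps\<close>)
  qed
  then show "real (sweep_column i j w (i, 0)) = K j - H j"
    "\<And>k. k < j \<Longrightarrow> real (sweep_column i j w (0, Suc k)) = K (Suc k) - K k"
    "\<And>k. j \<le> k \<Longrightarrow> sweep_column i j w (0, Suc k) = w (0, Suc k)"
    "\<And>k. j < k \<Longrightarrow> sweep_column i j w (i, k) = w (i, k)"
    "\<And>x y. x \<noteq> i \<Longrightarrow> 0 < x \<Longrightarrow> sweep_column i j w (x, y) = w (x, y)"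
    by blast+
qed

lemma sweep_columns_increments:
  assumes w: "w (0, 0) = 0"
  shows "(\<forall>j<n. real (sweep_columns n m w (0, Suc j)) =
      last_passage (real_field w) (Suc m) (Suc (Suc j)) - last_passage (real_field w) (Suc m) (Suc j)) \<and>
    (\<forall>x>m. \<forall>y. sweep_columns n m w (x, y) = w (x, y))"
proof (induction m)
  case 0
  have "boundary_field (real_field w)" using w by (simp add: boundary_field_def)
  then show ?case
    by (simp add: last_passage_col col_sum_def del: last_passage.simps(3))
next
  case (Suc m)
  let ?v = "sweep_columns n m w"
  have bf: "boundary_field (real_field w)" using w by (simp add: boundary_field_def)
  define H where "H j = last_passage (real_field w) (Suc m) (Suc j)" for j
  define K where "K j = last_passage (real_field w) (Suc (Suc m)) (Suc j)" for j
  have K0: "K 0 = H 0 + ?v (Suc m, 0)"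
    using Suc.IH bf by (simp add: H_def K_def last_passage_row row_sum_def del: last_passage.simps(3))
  have K: "K (Suc j) = max (H (Suc j)) (K j) + ?v (Suc m, Suc j)" for j
    using Suc.IH unfolding H_def K_def by (subst last_passage.simps(3)) simp
  have H: "H (Suc j) - H j = ?v (0, Suc j)" if "j < n" for j
    using Suc.IH that by (simp add: H_def del: last_passage.simps(3))
  note S = sweep_column_increments[of "Suc m" K H ?v n n, OF _ K0 K H]
  show ?case
    using S(2) S(5) Suc.IH by (simp add: K_def del: last_passage.simps(3))
qed

text \<open>
  The origin is left out, so that it receives the default weight \<open>0\<close> in \<open>stationary_pmf\<close>.
\<close>
definition stationary_box :: "nat \<Rightarrow> nat \<Rightarrow> (nat \<times> nat) set" where
  "stationary_box m n = {..m} \<times> {..n} - {(0, 0)}"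

text \<open>
  The boundary weights are those of an environment prolonged by \<open>a\<^sub>0 = z\<close> and \<open>b\<^sub>0 = 1 / z\<close>.  As
  \<open>a\<^sub>0 * b\<^sub>0 = 1\<close>, the parameter of an inner site is the product of the parameters of its two
  projections to the axes, which is the condition for the corner flip to preserve the law.
\<close>
definition stationary_parameter :: "real \<Rightarrow> (nat \<Rightarrow> real) \<Rightarrow> (nat \<Rightarrow> real) \<Rightarrow> nat \<times> nat \<Rightarrow> real" where
  "stationary_parameter z a b = (\<lambda>(i, j). case_nat z a i * case_nat (1 / z) b j)"

definition stationary_pmf ::
    "real \<Rightarrow> (nat \<Rightarrow> real) \<Rightarrow> (nat \<Rightarrow> real) \<Rightarrow> nat \<Rightarrow> nat \<Rightarrow> (nat \<times> nat \<Rightarrow> nat) pmf" where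
  "stationary_pmf z a b m n =
     Pi_pmf (stationary_box m n) 0 (\<lambda>x. geom (stationary_parameter z a b x))"

lemma finite_stationary_box [simp]: "finite (stationary_box m n)"
  by (simp add: stationary_box_def)

lemma stationary_parameter_simps [simp]:
  "stationary_parameter z a b (Suc i, 0) = a i / z"
  "stationary_parameter z a b (0, Suc j) = z * b j"
  "stationary_parameter z a b (Suc i, Suc j) = a i * b j"
  by (simp_all add: stationary_parameter_def)

lemma stationary_support:
  assumes "w \<in> set_pmf (stationary_pmf z a b m n)" shows "w (0, 0) = 0"
  using assms set_Pi_pmf_subset[OF finite_stationary_box]
  by (fastforce simp: stationary_pmf_def stationary_box_def)

definition subcritical :: "real \<Rightarrow> (nat \<Rightarrow> real) \<Rightarrow> (nat \<Rightarrow> real) \<Rightarrow> bool" where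
  "subcritical z a b \<longleftrightarrow> 0 < z \<and> (\<forall>i. 0 < a i \<and> a i < z) \<and> (\<forall>j. 0 < b j \<and> z * b j < 1)"

lemma sweep_column_preserves:
  assumes sub: "subcritical z a b" and "i < m" "j \<le> n"
  shows "map_pmf (sweep_column (Suc i) j) (stationary_pmf z a b m n) = stationary_pmf z a b m n"
  using \<open>j \<le> n\<close>
proof (induction j)
  case 0
  have "sweep_column (Suc i) 0 = id" by (simp add: fun_eq_iff)
  then show ?case by (simp add: pmf.map_id)
next
  case (Suc j)
  have z: "0 < z" "0 < a i" "a i < z" "0 < b j" "z * b j < 1"
    using sub by (auto simp: subcritical_def)
  have *: "sweep_column (Suc i) (Suc j) =
      corner_flip (Suc i, 0) (0, Suc j) (Suc i, Suc j) \<circ> sweep_column (Suc i) j"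
    by (simp add: fun_eq_iff)
  have "map_pmf (sweep_column (Suc i) (Suc j)) (stationary_pmf z a b m n) =
      map_pmf (corner_flip (Suc i, 0) (0, Suc j) (Suc i, Suc j)) (stationary_pmf z a b m n)"
    unfolding * map_pmf_compose using Suc by simp
  also have "\<dots> = stationary_pmf z a b m n"
    unfolding stationary_pmf_def
    by (rule Pi_pmf_corner_flip[where r = "a i / z" and s = "z * b j"])
       (use Suc.prems \<open>i < m\<close> z in \<open>auto simp: stationary_box_def\<close>)
  finally show ?case .
qed

lemma sweep_columns_preserves:
  assumes "subcritical z a b" "k \<le> m"
  shows "map_pmf (sweep_columns n k) (stationary_pmf z a b m n) = stationary_pmf z a b m n"
  using \<open>k \<le> m\<close>
proof (induction k)
  case 0
  have "sweep_columns n 0 = id" by (simp add: fun_eq_iff)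
  then show ?case by (simp add: pmf.map_id)
next
  case (Suc k)
  have *: "sweep_columns n (Suc k) = sweep_column (Suc k) n \<circ> sweep_columns n k"
    by (simp add: fun_eq_iff)
  show ?case
    unfolding * map_pmf_compose using Suc sweep_column_preserves[OF assms(1), of k m n n] by simp
qed

text \<open>
  Burke's property.  A sweep consists of corner flips and hence preserves the product law, and
  afterwards the slots of column \<open>0\<close> hold the vertical increments of the passage time along the right
  side of the rectangle.  So these increments have the joint law of the vertical boundary weights;
  only the law of their sum is recorded.
\<close>
theorem burke:
  assumes "subcritical z a b"
  shows "map_pmf (\<lambda>w. last_passage (real_field w) (Suc m) (Suc n) - row_sum (real_field w) m)
      (stationary_pmf z a b m n) =
    map_pmf (\<lambda>w. col_sum (real_field w) n) (stationary_pmf z a b m n)"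
proof -
  let ?P = "stationary_pmf z a b m n"
  have "map_pmf (\<lambda>w. col_sum (real_field w) n) ?P =
      map_pmf (\<lambda>w. col_sum (real_field w) n) (map_pmf (sweep_columns n m) ?P)"
    using assms by (simp add: sweep_columns_preserves)
  also have "\<dots> = map_pmf (\<lambda>w. last_passage (real_field w) (Suc m) (Suc n) - row_sum (real_field w) m) ?P"
    unfolding map_pmf_comp
  proof (rule map_pmf_cong[OF refl])
    fix w assume "w \<in> set_pmf ?P"
    then have w: "w (0, 0) = 0" by (rule stationary_support)
    let ?G = "\<lambda>j. last_passage (real_field w) (Suc m) (Suc j)"
    have "col_sum (real_field (sweep_columns n m w)) n = (\<Sum>j<n. ?G (Suc j) - ?G j)"
      unfolding col_sum_def using sweep_columns_increments[of w n m, OF w] by (intro sum.cong) auto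
    also have "\<dots> = ?G n - ?G 0" by (rule sum_lessThan_telescope)
    also have "?G 0 = row_sum (real_field w) m"
      using w by (intro last_passage_row) (simp add: boundary_field_def)
    finally show "col_sum (real_field (sweep_columns n m w)) n =
        last_passage (real_field w) (Suc m) (Suc n) - row_sum (real_field w) m" .
  qed
  finally show ?thesis by simp
qed

section \<open>Passage times under the quenched law\<close>

lemma measurable_last_passage_PiM:
  assumes "i \<le> m" "j \<le> n"
  shows "(\<lambda>W. last_passage W i j) \<in> borel_measurable (PiM ({..<m} \<times> {..<n}) (\<lambda>_. borel))"
  using assms
proof (induction i arbitrary: j)
  case (Suc i)
  note outer = Suc
  show ?case using \<open>j \<le> n\<close>
  proof (induction j)
    case (Suc j)
    have [measurable]: "(\<lambda>W. last_passage W i (Suc j)) \<in> borel_measurable (PiM ({..<m} \<times> {..<n}) (\<lambda>_. borel))"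
      "(\<lambda>W. last_passage W (Suc i) j) \<in> borel_measurable (PiM ({..<m} \<times> {..<n}) (\<lambda>_. borel))"
      using outer Suc by auto
    have [measurable]: "(\<lambda>W. W (i, j)) \<in> borel_measurable (PiM ({..<m} \<times> {..<n}) (\<lambda>_. borel))"
      using outer(3) outer(2) Suc(2) by (intro measurable_component_singleton) auto
    show ?case unfolding last_passage.simps(3) by measurable
  qed simp
qed simp

lemma distr_map_pmf_geom: "distr (measure_pmf (geom r)) borel real = geometric_weight r"
  by (simp add: geometric_weight_def geom_def)

lemma prob_space_quenched_law: "prob_space (quenched_law a b)"
  by (auto simp: quenched_law_def intro!: prob_space_PiM prob_space_geometric_weight)

lemma sets_quenched_law [measurable_cong]: "sets (quenched_law a b) = sets (\<Pi>\<^sub>M (ij :: nat \<times> nat)\<in>UNIV. borel)"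
  by (auto simp: quenched_law_def intro!: sets_PiM_cong)

lemma space_quenched_law [simp]: "space (quenched_law a b) = UNIV"
  using sets_eq_imp_space_eq[OF sets_quenched_law] by (simp add: space_PiM)

lemma distr_quenched_law_rectangle:
  fixes a b :: "nat \<Rightarrow> real" and m n :: nat
  defines "I \<equiv> {..<m} \<times> {..<n}"
  shows "distr (quenched_law a b) (PiM I (\<lambda>_. borel)) (\<lambda>W. restrict W I) =
    PiM I (\<lambda>(i, j). geometric_weight (a i * b j))"
proof -
  interpret product_prob_space "\<lambda>(i, j). geometric_weight (a i * b j)" UNIV
    by (intro product_prob_spaceI) (auto simp: prob_space_geometric_weight)
  have "distr (quenched_law a b) (PiM I (\<lambda>(i, j). geometric_weight (a i * b j))) (\<lambda>W. restrict W I) =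
      PiM I (\<lambda>(i, j). geometric_weight (a i * b j))"
    unfolding quenched_law_def by (rule distr_PiM_restrict_finite) (auto simp: I_def)
  moreover have "sets (PiM I (\<lambda>(i, j). geometric_weight (a i * b j))) = sets (PiM I (\<lambda>_. borel))"
    by (rule sets_PiM_cong) auto
  ultimately show ?thesis by (subst (asm) distr_cong[OF refl _ refl]) auto
qed

lemma distr_stationary_rectangle:
  fixes a b :: "nat \<Rightarrow> real" and m n :: nat
  defines "I \<equiv> {..<m} \<times> {..<n}"
  assumes ne: "0 < m" "0 < n"
  shows "distr (stationary_pmf z a b m n) (PiM I (\<lambda>_. borel)) (\<lambda>w. restrict (bulk (real_field w)) I) =
    PiM I (\<lambda>(i, j). geometric_weight (a i * b j))"
proof -
  let ?A = "stationary_box m n" and ?P = "stationary_pmf z a b m n"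
  let ?N = "\<lambda>x. distr ?P borel (\<lambda>w. real (w x))"
  let ?t = "\<lambda>(i, j). (Suc i, Suc j)"
  have A: "?A \<noteq> {}" using ne by (auto simp: stationary_box_def)
  have "prob_space.indep_vars ?P (\<lambda>_. count_space UNIV) (\<lambda>x f. f x) ?A"
    unfolding stationary_pmf_def by (rule indep_vars_Pi_pmf) simp
  then have "prob_space.indep_vars ?P (\<lambda>_. borel) (\<lambda>x f. real (f x)) ?A"
    by (rule prob_space.indep_vars_compose2[OF measure_pmf.prob_space_axioms]) auto
  then have all: "distr ?P (PiM ?A (\<lambda>_. borel)) (\<lambda>w. \<lambda>x\<in>?A. real (w x)) = PiM ?A ?N"
    using A by (subst (asm) prob_space.indep_vars_iff_distr_eq_PiM'[OF measure_pmf.prob_space_axioms]) auto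
  interpret product_prob_space ?N UNIV
    by (intro product_prob_spaceI prob_space.prob_space_distr measure_pmf.prob_space_axioms) auto
  have tI: "?t \<in> I \<rightarrow> ?A" by (auto simp: I_def stationary_box_def)
  have M1: "(\<lambda>\<omega>. \<lambda>n\<in>I. \<omega> (?t n)) \<in> PiM ?A (\<lambda>_. borel :: real measure) \<rightarrow>\<^sub>M PiM I (\<lambda>_. borel)"
    by (intro measurable_restrict measurable_component_singleton funcset_mem[OF tI])
  have M2: "(\<lambda>w. \<lambda>x\<in>?A. real (w x)) \<in> measure_pmf ?P \<rightarrow>\<^sub>M PiM ?A (\<lambda>_. borel)"
    by (simp add: space_PiM)
  have "distr (PiM ?A ?N) (PiM I (\<lambda>x. ?N (?t x))) (\<lambda>\<omega>. \<lambda>n\<in>I. \<omega> (?t n)) = PiM I (\<lambda>x. ?N (?t x))"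
    using tI by (intro distr_reorder) (auto simp: inj_on_def)
  moreover have "sets (PiM I (\<lambda>x. ?N (?t x))) = sets (PiM I (\<lambda>_. borel))"
    by (rule sets_PiM_cong) auto
  ultimately have "distr (PiM ?A ?N) (PiM I (\<lambda>_. borel)) (\<lambda>\<omega>. \<lambda>n\<in>I. \<omega> (?t n)) = PiM I (\<lambda>x. ?N (?t x))"
    by (subst (asm) distr_cong[OF refl _ refl]) auto
  then have "distr ?P (PiM I (\<lambda>_. borel)) ((\<lambda>\<omega>. \<lambda>n\<in>I. \<omega> (?t n)) \<circ> (\<lambda>w. \<lambda>x\<in>?A. real (w x))) =
      PiM I (\<lambda>x. ?N (?t x))"
    unfolding all[symmetric]
    by (subst (asm) distr_distr[OF M1 M2])
  moreover have "(\<lambda>\<omega>. \<lambda>n\<in>I. \<omega> (?t n)) \<circ> (\<lambda>w. \<lambda>x\<in>?A. real (w x)) = (\<lambda>w. restrict (bulk (real_field w)) I)"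
    using funcset_mem[OF tI] by (fastforce simp: fun_eq_iff bulk_def restrict_def)
  moreover have "PiM I (\<lambda>x. ?N (?t x)) = PiM I (\<lambda>(i, j). geometric_weight (a i * b j))"
  proof (rule PiM_cong[OF refl])
    fix x assume "x \<in> I"
    obtain i j where x: "x = (i, j)" "(Suc i, Suc j) \<in> ?A"
      using funcset_mem[OF tI \<open>x \<in> I\<close>] by (cases x) auto
    have "geom (a i * b j) = map_pmf (\<lambda>w. w (Suc i, Suc j)) ?P"
      using x by (simp add: stationary_pmf_def Pi_pmf_component)
    then have "geometric_weight (a i * b j) = distr (map_pmf (\<lambda>w. w (Suc i, Suc j)) ?P) borel real"
      by (simp add: distr_map_pmf_geom[symmetric])
    also have "\<dots> = ?N (Suc i, Suc j)"
      by (simp add: map_pmf_rep_eq distr_distr comp_def)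
    finally show "?N (?t x) = (case x of (i, j) \<Rightarrow> geometric_weight (a i * b j))"
      by (simp add: x)
  qed
  ultimately show ?thesis by simp
qed

text \<open>
  The passage time depends on finitely many weights.  Under both laws these are independent with the
  same marginals, so the bulk of the stationary model is a copy of the original model.
\<close>
lemma quenched_last_passage_prob:
  assumes X[measurable]: "X \<in> sets borel"
  shows "measure (quenched_law a b) {W. last_passage W m n \<in> X} =
    measure_pmf.prob (stationary_pmf z a b m n) {w. last_passage (bulk (real_field w)) m n \<in> X}"
proof (cases "m = 0 \<or> n = 0")
  case True
  then have "last_passage W m n = 0" for W by auto
  then show ?thesis
    using prob_space.prob_space[OF prob_space_quenched_law, of a b] by simp
next
  case False
  let ?I = "{..<m} \<times> {..<n}"
  let ?E = "{W \<in> space (PiM ?I (\<lambda>_. borel)). last_passage W m n \<in> X}"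
  have [measurable]: "(\<lambda>W. last_passage W m n) \<in> borel_measurable (PiM ?I (\<lambda>_. borel))"
    by (rule measurable_last_passage_PiM) auto
  have E: "?E \<in> sets (PiM ?I (\<lambda>_. borel))" by measurable
  have R: "(\<lambda>W. restrict W ?I) \<in> quenched_law a b \<rightarrow>\<^sub>M PiM ?I (\<lambda>_. borel)"
    by (subst measurable_cong_sets[OF sets_quenched_law refl]) (rule measurable_restrict_subset, simp)
  have restr: "last_passage (restrict W ?I) m n = last_passage W m n" for W
    by (rule last_passage_cong) auto
  have "measure (quenched_law a b) {W. last_passage W m n \<in> X} =
      measure (distr (quenched_law a b) (PiM ?I (\<lambda>_. borel)) (\<lambda>W. restrict W ?I)) ?E"
    by (subst measure_distr[OF R E]) (auto simp: restr space_PiM intro!: arg_cong[where f = "measure _"])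
  also have "\<dots> = measure (distr (stationary_pmf z a b m n) (PiM ?I (\<lambda>_. borel))
      (\<lambda>w. restrict (bulk (real_field w)) ?I)) ?E"
    using False by (simp add: distr_quenched_law_rectangle distr_stationary_rectangle)
  also have "\<dots> = measure_pmf.prob (stationary_pmf z a b m n) {w. last_passage (bulk (real_field w)) m n \<in> X}"
    by (subst measure_distr[OF _ E]) (auto simp: restr space_PiM intro!: arg_cong[where f = "measure _"])
  finally show ?thesis .
qed

section \<open>The law of large numbers for boundary sums\<close>

abbreviation scaled :: "nat \<Rightarrow> real \<Rightarrow> nat" where
  "scaled N s \<equiv> nat \<lfloor>real N * s\<rfloor>"

lemma scaled_le: "0 \<le> s \<Longrightarrow> real (scaled N s) \<le> real N * s"
  by simp

lemma scaled_average:
  assumes avg: "(\<lambda>n. (\<Sum>i<n. f i) / real n) \<longlonglongrightarrow> (A::real)" and s: "s > 0"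
  shows "(\<lambda>N. (\<Sum>i<scaled N s. f i) / real N) \<longlonglongrightarrow> s * A"
proof -
  have lim: "filterlim (\<lambda>N. scaled N s) at_top sequentially"
    using s by real_asymp
  have "(\<lambda>N. (\<Sum>i<scaled N s. f i) / real (scaled N s)) \<longlonglongrightarrow> A"
    using filterlim_compose[OF avg lim] .
  moreover have "(\<lambda>N. real (scaled N s) / real N) \<longlonglongrightarrow> s"
    using s by real_asymp
  ultimately have "(\<lambda>N. real (scaled N s) / real N * ((\<Sum>i<scaled N s. f i) / real (scaled N s))) \<longlonglongrightarrow> s * A"
    by (intro tendsto_mult)
  moreover have "real (scaled N s) / real N * ((\<Sum>i<scaled N s. f i) / real (scaled N s)) =
      (\<Sum>i<scaled N s. f i) / real N" for N
    by (cases "scaled N s = 0") auto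
  ultimately show ?thesis by simp
qed

text \<open>
  The mean of the sum is close to \<open>N * (s * v)\<close> by the hypothesis on the averages, and the fluctuations
  around the mean are of order \<open>sqrt N\<close> by Chebyshev's inequality.  The index set \<open>A N\<close> of the ambient
  product may grow with \<open>N\<close>.
\<close>
lemma geometric_law_of_large_numbers:
  fixes h :: "nat \<Rightarrow> 'i" and A :: "nat \<Rightarrow> 'i set"
  assumes fin: "\<And>N. finite (A N)" and h: "inj h"
    and hA: "\<And>N i. i < scaled N s \<Longrightarrow> h i \<in> A N"
    and p: "\<And>i. p (h i) = geom (r i)"
    and r: "\<And>i. 0 \<le> r i" "\<And>i. r i \<le> r0" "r0 < 1"
    and avg: "(\<lambda>n. (\<Sum>i<n. r i / (1 - r i)) / real n) \<longlonglongrightarrow> v"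
    and s: "s > 0" and e: "e > 0"
  shows "(\<lambda>N. measure_pmf.prob (Pi_pmf (A N) 0 p)
    {w. real N * e \<le> \<bar>(\<Sum>i<scaled N s. real (w (h i))) - real N * (s * v)\<bar>}) \<longlonglongrightarrow> 0"
proof (rule tendsto_sandwich[where f = "\<lambda>_. 0"])
  let ?C = "geom_second_moment_bound r0"
  let ?mean = "\<lambda>N. \<Sum>i<scaled N s. r i / (1 - r i)"
  have C: "0 \<le> ?C"
    using r(1)[of 0] r(2)[of 0] by (auto simp: geom_second_moment_bound_def intro!: suminf_nonneg summable_square_geometric r(3))
  show "\<forall>\<^sub>F N in sequentially. 0 \<le> measure_pmf.prob (Pi_pmf (A N) 0 p)
    {w. real N * e \<le> \<bar>(\<Sum>i<scaled N s. real (w (h i))) - real N * (s * v)\<bar>}" by simp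
  show "(\<lambda>N. real N * s * ?C / (real N * (e / 2))\<^sup>2) \<longlonglongrightarrow> 0"
    using e by real_asymp
  have "\<forall>\<^sub>F N in sequentially. dist (?mean N / real N) (s * v) < e / 2"
    using scaled_average[OF avg s] e by (intro tendstoD) auto
  then show "\<forall>\<^sub>F N in sequentially. measure_pmf.prob (Pi_pmf (A N) 0 p)
      {w. real N * e \<le> \<bar>(\<Sum>i<scaled N s. real (w (h i))) - real N * (s * v)\<bar>} \<le>
      real N * s * ?C / (real N * (e / 2))\<^sup>2"
    using eventually_gt_at_top[of 0]
  proof eventually_elim
    case (elim N)
    let ?P = "Pi_pmf (A N) 0 p" and ?I = "h ` {..<scaled N s}"
    have inj: "inj_on h {..<scaled N s}" using h by (rule inj_on_subset) simp
    have "real N * \<bar>?mean N / real N - s * v\<bar> < real N * (e / 2)"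
      using elim by (intro mult_strict_left_mono) (auto simp: dist_real_def)
    moreover have "real N * \<bar>?mean N / real N - s * v\<bar> = \<bar>?mean N - real N * (s * v)\<bar>"
      using elim by (simp add: abs_mult_pos' right_diff_distrib)
    ultimately have near: "\<bar>?mean N - real N * (s * v)\<bar> < real N * (e / 2)" by simp
    have "measure_pmf.prob ?P {w. real N * e \<le> \<bar>(\<Sum>i<scaled N s. real (w (h i))) - real N * (s * v)\<bar>} \<le>
        measure_pmf.prob ?P {w. real N * (e / 2) \<le> \<bar>(\<Sum>i\<in>?I. real (w i)) - (\<Sum>i\<in>?I. r (inv h i) / (1 - r (inv h i)))\<bar>}"
    proof (rule measure_pmf.finite_measure_mono; clarify?)
      fix w assume "real N * e \<le> \<bar>(\<Sum>i<scaled N s. real (w (h i))) - real N * (s * v)\<bar>"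
      then have "real N * (e / 2) \<le> \<bar>(\<Sum>i<scaled N s. real (w (h i))) - ?mean N\<bar>"
        using near by linarith
      then show "real N * (e / 2) \<le> \<bar>(\<Sum>i\<in>?I. real (w i)) - (\<Sum>i\<in>?I. r (inv h i) / (1 - r (inv h i)))\<bar>"
        by (simp only: sum.reindex[OF inj] comp_def inv_f_f[OF h])
    qed simp
    also have "\<dots> \<le> card ?I * ?C / (real N * (e / 2))\<^sup>2"
      using hA elim e h by (intro geometric_sum_deviation) (auto simp: p r fin)
    also have "\<dots> \<le> real N * s * ?C / (real N * (e / 2))\<^sup>2"
      using scaled_le[of s N] s C by (intro divide_right_mono mult_right_mono) (auto simp: card_image[OF inj])
    finally show ?case .
  qed
qed simp

section \<open>Coupling of stationary models\<close>

lemma Pi_pmf_triple_coupling: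
  fixes p1 p2 p3 :: "'i \<Rightarrow> nat pmf"
  assumes A: "finite A"
    and site: "\<And>x. x \<in> A \<Longrightarrow> \<exists>k. map_pmf fst k = p1 x \<and> map_pmf (fst \<circ> snd) k = p2 x \<and>
      map_pmf (snd \<circ> snd) k = p3 x \<and> (\<forall>(u, v, w)\<in>set_pmf k. R x u v w)"
    and R0: "\<And>x. R x 0 0 0"
  obtains c where "map_pmf fst c = Pi_pmf A 0 p1" "map_pmf (fst \<circ> snd) c = Pi_pmf A 0 p2"
    "map_pmf (snd \<circ> snd) c = Pi_pmf A 0 p3"
    "\<And>u v w x. (u, v, w) \<in> set_pmf c \<Longrightarrow> R x (u x) (v x) (w x)"
proof -
  obtain k where k: "\<And>x. x \<in> A \<Longrightarrow> map_pmf fst (k x) = p1 x" "\<And>x. x \<in> A \<Longrightarrow> map_pmf (fst \<circ> snd) (k x) = p2 x"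
    "\<And>x. x \<in> A \<Longrightarrow> map_pmf (snd \<circ> snd) (k x) = p3 x"
    "\<And>x. x \<in> A \<Longrightarrow> \<forall>(u, v, w)\<in>set_pmf (k x). R x u v w"
    using site by metis
  define C where "C = Pi_pmf A (0, 0, 0) k"
  define c where "c = map_pmf (\<lambda>f. (fst \<circ> f, (fst \<circ> snd) \<circ> f, (snd \<circ> snd) \<circ> f)) C"
  have "map_pmf fst c = map_pmf (\<lambda>f. fst \<circ> f) C" by (simp add: c_def map_pmf_comp)
  also have "\<dots> = Pi_pmf A 0 p1"
    unfolding C_def by (subst Pi_pmf_map[OF A, symmetric]) (auto intro!: Pi_pmf_cong simp: k)
  finally have 1: "map_pmf fst c = Pi_pmf A 0 p1" .
  have "map_pmf (fst \<circ> snd) c = map_pmf (\<lambda>f. (fst \<circ> snd) \<circ> f) C" by (simp add: c_def map_pmf_comp comp_def)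
  also have "\<dots> = Pi_pmf A 0 p2"
    unfolding C_def by (subst Pi_pmf_map[OF A, symmetric]) (auto intro!: Pi_pmf_cong simp: k)
  finally have 2: "map_pmf (fst \<circ> snd) c = Pi_pmf A 0 p2" .
  have "map_pmf (snd \<circ> snd) c = map_pmf (\<lambda>f. (snd \<circ> snd) \<circ> f) C" by (simp add: c_def map_pmf_comp comp_def)
  also have "\<dots> = Pi_pmf A 0 p3"
    unfolding C_def by (subst Pi_pmf_map[OF A, symmetric]) (auto intro!: Pi_pmf_cong simp: k)
  finally have 3: "map_pmf (snd \<circ> snd) c = Pi_pmf A 0 p3" .
  have "R x (u x) (v x) (w x)" if uvw0: "(u, v, w) \<in> set_pmf c" for u v w x
  proof -
    obtain f where f: "f \<in> set_pmf C" and uvw: "u = fst \<circ> f" "v = (fst \<circ> snd) \<circ> f" "w = (snd \<circ> snd) \<circ> f"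
      using uvw0 by (auto simp: c_def)
    show ?thesis
    proof (cases "x \<in> A")
      case True
      then have "f x \<in> set_pmf (k x)" using f A by (auto simp: C_def set_Pi_pmf PiE_dflt_def)
      then show ?thesis using k(4)[OF True] by (auto simp: uvw split: prod.splits)
    next
      case False
      then have "f x = (0, 0, 0)" using f A by (auto simp: C_def set_Pi_pmf PiE_dflt_def)
      then show ?thesis using R0 by (simp add: uvw)
    qed
  qed
  then show ?thesis using that 1 2 3 by blast
qed

text \<open>
  The relation between the weights for a parameter \<open>z\<close> (the value \<open>u\<close>), a smaller parameter (\<open>v\<close>) and a
  larger one (\<open>w\<close>): decreasing \<open>z\<close> increases the horizontal boundary weights, increasing \<open>z\<close> increases
  the vertical ones, and the bulk is shared.
\<close>
definition coupled_at :: "nat \<times> nat \<Rightarrow> nat \<Rightarrow> nat \<Rightarrow> nat \<Rightarrow> bool" where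
  "coupled_at x u v w \<longleftrightarrow> (snd x = 0 \<longrightarrow> u \<le> v) \<and> (fst x = 0 \<longrightarrow> u \<le> w) \<and>
     (fst x \<noteq> 0 \<longrightarrow> snd x \<noteq> 0 \<longrightarrow> u = v \<and> u = w)"

lemma stationary_coupling:
  assumes sub: "subcritical z a b" "subcritical z' a b" "subcritical z'' a b" and z: "z' < z" "z < z''"
  obtains c where "map_pmf fst c = stationary_pmf z a b m n"
    "map_pmf (fst \<circ> snd) c = stationary_pmf z' a b m n"
    "map_pmf (snd \<circ> snd) c = stationary_pmf z'' a b m n"
    "\<And>u v w x. (u, v, w) \<in> set_pmf c \<Longrightarrow> coupled_at x (u x) (v x) (w x)"
proof -
  let ?p = "\<lambda>z x. geom (stationary_parameter z a b x)"
  have site: "\<exists>k. map_pmf fst k = ?p z x \<and> map_pmf (fst \<circ> snd) k = ?p z' x \<and>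
      map_pmf (snd \<circ> snd) k = ?p z'' x \<and> (\<forall>(u, v, w)\<in>set_pmf k. coupled_at x u v w)"
    if box: "x \<in> stationary_box m n" for x
  proof -
    have pos: "0 < z" "0 < z'" "0 < z''" "\<And>i. 0 < a i" "\<And>j. 0 < b j" "\<And>i. a i < z'" "\<And>j. z'' * b j < 1"
      using sub by (auto simp: subcritical_def)
    consider i where "x = (Suc i, 0)" | j where "x = (0, Suc j)" | i j where "x = (Suc i, Suc j)"
      using box by (cases x; cases "fst x"; cases "snd x") (auto simp: stationary_box_def)
    then show ?thesis
    proof cases
      \<comment> \<open>Horizontal axis: couple \<open>z\<close> with \<open>z'\<close>, and add an independent third weight.\<close>
      case 1
      have "0 < a i / z" "a i / z < a i / z'" "a i / z' < 1"
        using pos z by (auto intro!: divide_strict_left_mono)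
      then obtain c where c: "map_pmf fst c = geom (a i / z)" "map_pmf snd c = geom (a i / z')"
        "\<And>u v. (u, v) \<in> set_pmf c \<Longrightarrow> u \<le> v"
        by (rule geom_monotone_coupling) blast
      show ?thesis
      proof (intro exI conjI)
        let ?k = "map_pmf (\<lambda>((u, v), w). (u, v, w)) (pair_pmf c (?p z'' x))"
        have "map_pmf fst ?k = map_pmf fst (map_pmf fst (pair_pmf c (?p z'' x)))"
          by (simp add: map_pmf_comp case_prod_unfold)
        then show "map_pmf fst ?k = ?p z x" using c by (simp add: map_fst_pair_pmf 1)
        have "map_pmf (fst \<circ> snd) ?k = map_pmf snd (map_pmf fst (pair_pmf c (?p z'' x)))"
          by (simp add: map_pmf_comp case_prod_unfold)
        then show "map_pmf (fst \<circ> snd) ?k = ?p z' x" using c by (simp add: map_fst_pair_pmf 1)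
        have "map_pmf (snd \<circ> snd) ?k = map_pmf snd (pair_pmf c (?p z'' x))"
          by (simp add: map_pmf_comp case_prod_unfold)
        then show "map_pmf (snd \<circ> snd) ?k = ?p z'' x" by (simp add: map_snd_pair_pmf)
        show "\<forall>(u, v, w)\<in>set_pmf ?k. coupled_at x u v w"
          using c(3) by (auto simp: coupled_at_def 1)
      qed
    next
      \<comment> \<open>Vertical axis: couple \<open>z\<close> with \<open>z''\<close>, and add an independent third weight.\<close>
      case 2
      have "0 < z * b j" "z * b j < z'' * b j" "z'' * b j < 1"
        using pos z by auto
      then obtain c where c: "map_pmf fst c = geom (z * b j)" "map_pmf snd c = geom (z'' * b j)"
        "\<And>u v. (u, v) \<in> set_pmf c \<Longrightarrow> u \<le> v"
        by (rule geom_monotone_coupling) blast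
      show ?thesis
      proof (intro exI conjI)
        let ?k = "map_pmf (\<lambda>((u, w), v). (u, v, w)) (pair_pmf c (?p z' x))"
        have "map_pmf fst ?k = map_pmf fst (map_pmf fst (pair_pmf c (?p z' x)))"
          by (simp add: map_pmf_comp case_prod_unfold)
        then show "map_pmf fst ?k = ?p z x" using c by (simp add: map_fst_pair_pmf 2)
        have "map_pmf (snd \<circ> snd) ?k = map_pmf snd (map_pmf fst (pair_pmf c (?p z' x)))"
          by (simp add: map_pmf_comp case_prod_unfold)
        then show "map_pmf (snd \<circ> snd) ?k = ?p z'' x" using c by (simp add: map_fst_pair_pmf 2)
        have "map_pmf (fst \<circ> snd) ?k = map_pmf snd (pair_pmf c (?p z' x))"
          by (simp add: map_pmf_comp case_prod_unfold)
        then show "map_pmf (fst \<circ> snd) ?k = ?p z' x" by (simp add: map_snd_pair_pmf)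
        show "\<forall>(u, v, w)\<in>set_pmf ?k. coupled_at x u v w"
          using c(3) by (auto simp: coupled_at_def 2)
      qed
    next
      case 3
      let ?k = "map_pmf (\<lambda>u. (u, u, u)) (?p z x)"
      show ?thesis
        by (intro exI[of _ ?k]) (auto simp: map_pmf_comp 3 coupled_at_def)
    qed
  qed
  show ?thesis
    by (rule Pi_pmf_triple_coupling[OF finite_stationary_box site])
       (use that in \<open>auto simp: coupled_at_def stationary_pmf_def\<close>)
qed

section \<open>Quenched limits\<close>

lemma prob_triple_union:
  fixes c :: "('a \<times> 'a \<times> 'a) pmf"
  shows "measure_pmf.prob c {(u, v, w). u \<in> D1 \<or> v \<in> D2 \<or> w \<in> D3 \<or> u \<in> D4 \<or> v \<in> D5 \<or> u \<in> D6 \<or> w \<in> D7} \<le>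
    measure_pmf.prob (map_pmf fst c) D1 + measure_pmf.prob (map_pmf (fst \<circ> snd) c) D2 +
    measure_pmf.prob (map_pmf (snd \<circ> snd) c) D3 + measure_pmf.prob (map_pmf fst c) D4 +
    measure_pmf.prob (map_pmf (fst \<circ> snd) c) D5 + measure_pmf.prob (map_pmf fst c) D6 +
    measure_pmf.prob (map_pmf (snd \<circ> snd) c) D7"
proof -
  have "{(u, v, w). u \<in> D1 \<or> v \<in> D2 \<or> w \<in> D3 \<or> u \<in> D4 \<or> v \<in> D5 \<or> u \<in> D6 \<or> w \<in> D7} =
      fst -` D1 \<union> (fst \<circ> snd) -` D2 \<union> (snd \<circ> snd) -` D3 \<union> fst -` D4 \<union> (fst \<circ> snd) -` D5 \<union>
      fst -` D6 \<union> (snd \<circ> snd) -` D7"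
    by auto
  also have "measure_pmf.prob c \<dots> \<le> measure_pmf.prob (map_pmf fst c) D1 +
      measure_pmf.prob (map_pmf (fst \<circ> snd) c) D2 +
      measure_pmf.prob (map_pmf (snd \<circ> snd) c) D3 + measure_pmf.prob (map_pmf fst c) D4 +
      measure_pmf.prob (map_pmf (fst \<circ> snd) c) D5 + measure_pmf.prob (map_pmf fst c) D6 +
      measure_pmf.prob (map_pmf (snd \<circ> snd) c) D7"
    unfolding measure_map_pmf
    by (intro order_trans[OF measure_Un_le] add_mono order_refl) auto
  finally show ?thesis .
qed

text \<open>
  One realisation of the environment.  The bound \<open>\<sigma> < 1\<close> leaves room for boundary parameters: every \<open>z\<close>
  between \<open>\<sigma>\<close> and \<open>1 / \<sigma>\<close> keeps \<open>a\<^sub>i / z\<close> and \<open>z * b\<^sub>j\<close> bounded away from \<open>1\<close>.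
\<close>
locale corner_environment =
  fixes a b :: "nat \<Rightarrow> real" and \<sigma> :: real
  assumes a: "\<And>i. 0 < a i" "\<And>i. a i \<le> \<sigma>" and b: "\<And>j. 0 < b j" "\<And>j. b j \<le> \<sigma>" and \<sigma>: "\<sigma> < 1"
begin

text \<open>
  The parameter \<open>z\<close> defines a stationary model, uniformly in the sites, and the mean boundary weights
  \<open>a\<^sub>i / (z - a\<^sub>i)\<close> and \<open>z b\<^sub>j / (1 - z b\<^sub>j)\<close> have averages \<open>A\<close> and \<open>B\<close>.
\<close>
definition admissible :: "real \<Rightarrow> real \<Rightarrow> real \<Rightarrow> bool" where
  "admissible z A B \<longleftrightarrow> \<sigma> < z \<and> z * \<sigma> < 1 \<and>
     (\<lambda>n. (\<Sum>i<n. a i / (z - a i)) / real n) \<longlonglongrightarrow> A \<and>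
     (\<lambda>n. (\<Sum>j<n. z * b j / (1 - z * b j)) / real n) \<longlonglongrightarrow> B"

lemma admissible_subcritical:
  assumes "admissible z A B" shows "subcritical z a b"
proof -
  have z: "\<sigma> < z" "z * \<sigma> < 1" using assms by (auto simp: admissible_def)
  have "0 < z" using a(1)[of 0] a(2)[of 0] z by linarith
  moreover have "a i < z" for i using a(2)[of i] z by linarith
  moreover have "z * b j < 1" for j
    using mult_left_mono[OF b(2)[of j], of z] \<open>0 < z\<close> z by linarith
  ultimately show ?thesis using a b by (auto simp: subcritical_def)
qed

lemma row_sum_lln:
  assumes z: "admissible z A B" and s: "s > 0" and e: "e > 0" and m: "\<And>N. scaled N s \<le> m N"
  shows "(\<lambda>N. measure_pmf.prob (stationary_pmf z a b (m N) (n N))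
    {w. real N * e \<le> \<bar>row_sum (real_field w) (scaled N s) - real N * (s * A)\<bar>}) \<longlonglongrightarrow> 0"
  unfolding stationary_pmf_def row_sum_def
proof (rule geometric_law_of_large_numbers[where h = "\<lambda>i. (Suc i, 0)" and r = "\<lambda>i. a i / z" and ?r0.0 = "\<sigma> / z"])
  have sub: "subcritical z a b" by (rule admissible_subcritical[OF z])
  then have z0: "0 < z" by (simp add: subcritical_def)
  show "0 \<le> a i / z" for i using a(1)[of i] z0 by simp
  show "a i / z \<le> \<sigma> / z" for i using a(2)[of i] z0 by (simp add: divide_right_mono)
  show "\<sigma> / z < 1" using z z0 by (simp add: admissible_def)
  have mean: "a i / z / (1 - a i / z) = a i / (z - a i)" for i
    using z0 sub by (simp add: divide_simps subcritical_def)
  show "(\<lambda>n. (\<Sum>i<n. a i / z / (1 - a i / z)) / real n) \<longlonglongrightarrow> A"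
    unfolding mean using z by (simp add: admissible_def)
  show "(Suc i, 0) \<in> stationary_box (m N) (n N)" if "i < scaled N s" for N i
    using that m[of N] by (simp add: stationary_box_def)
qed (use s e in \<open>auto simp: inj_on_def\<close>)

lemma col_sum_lln:
  assumes z: "admissible z A B" and s: "s > 0" and e: "e > 0" and n: "\<And>N. scaled N s \<le> n N"
  shows "(\<lambda>N. measure_pmf.prob (stationary_pmf z a b (m N) (n N))
    {w. real N * e \<le> \<bar>col_sum (real_field w) (scaled N s) - real N * (s * B)\<bar>}) \<longlonglongrightarrow> 0"
  unfolding stationary_pmf_def col_sum_def
proof (rule geometric_law_of_large_numbers[where h = "\<lambda>j. (0, Suc j)" and r = "\<lambda>j. z * b j" and ?r0.0 = "z * \<sigma>"])
  have sub: "subcritical z a b" by (rule admissible_subcritical[OF z])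
  then have z0: "0 < z" by (simp add: subcritical_def)
  show "0 \<le> z * b j" for j using b(1)[of j] z0 by simp
  show "z * b j \<le> z * \<sigma>" for j using b(2)[of j] z0 by simp
  show "z * \<sigma> < 1" using z by (simp add: admissible_def)
  show "(\<lambda>n. (\<Sum>j<n. z * b j / (1 - z * b j)) / real n) \<longlonglongrightarrow> B"
    using z by (simp add: admissible_def)
  show "(0, Suc j) \<in> stationary_box (m N) (n N)" if "j < scaled N s" for N j
    using that n[of N] by (simp add: stationary_box_def)
qed (use s e in \<open>auto simp: inj_on_def\<close>)

text \<open>
  The passage time is the boundary sum along the bottom plus the increment along the right side, and
  by \<open>burke\<close> the latter is distributed like the boundary sum along the left side.
\<close>
lemma stationary_passage_lln:
  assumes z: "admissible z A B" and s: "s > 0" and t: "t > 0" and e: "e > 0"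
  shows "(\<lambda>N. measure_pmf.prob (stationary_pmf z a b (scaled N s) (scaled N t))
    {w. real N * e \<le> \<bar>last_passage (real_field w) (Suc (scaled N s)) (Suc (scaled N t)) - real N * (s * A + t * B)\<bar>})
    \<longlonglongrightarrow> 0"
proof (rule Lim_null_comparison)
  let ?P = "\<lambda>N. stationary_pmf z a b (scaled N s) (scaled N t)"
  let ?row = "\<lambda>N. measure_pmf.prob (?P N)
    {w. real N * (e / 2) \<le> \<bar>row_sum (real_field w) (scaled N s) - real N * (s * A)\<bar>}"
  let ?col = "\<lambda>N. measure_pmf.prob (?P N)
    {w. real N * (e / 2) \<le> \<bar>col_sum (real_field w) (scaled N t) - real N * (t * B)\<bar>}"
  have "?row \<longlonglongrightarrow> 0" by (rule row_sum_lln[OF z s]) (use e in auto)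
  moreover have "?col \<longlonglongrightarrow> 0" by (rule col_sum_lln[OF z t]) (use e in auto)
  ultimately show "(\<lambda>N. ?row N + ?col N) \<longlonglongrightarrow> 0" by (rule tendsto_add_zero)
  show "\<forall>\<^sub>F N in sequentially. norm (measure_pmf.prob (?P N)
    {w. real N * e \<le> \<bar>last_passage (real_field w) (Suc (scaled N s)) (Suc (scaled N t)) - real N * (s * A + t * B)\<bar>})
     \<le> ?row N + ?col N"
  proof (intro always_eventually allI)
    fix N
    let ?inc = "\<lambda>w. last_passage (real_field w) (Suc (scaled N s)) (Suc (scaled N t)) - row_sum (real_field w) (scaled N s)"
    have "measure_pmf.prob (?P N) {w. real N * (e / 2) \<le> \<bar>?inc w - real N * (t * B)\<bar>} =
        measure_pmf.prob (map_pmf ?inc (?P N)) {x. real N * (e / 2) \<le> \<bar>x - real N * (t * B)\<bar>}"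
      by (simp add: measure_map_pmf vimage_def)
    also have "\<dots> = measure_pmf.prob (map_pmf (\<lambda>w. col_sum (real_field w) (scaled N t)) (?P N))
        {x. real N * (e / 2) \<le> \<bar>x - real N * (t * B)\<bar>}"
      by (simp only: burke[OF admissible_subcritical[OF z]])
    also have "\<dots> = ?col N" by (simp add: measure_map_pmf vimage_def)
    finally have inc: "measure_pmf.prob (?P N) {w. real N * (e / 2) \<le> \<bar>?inc w - real N * (t * B)\<bar>} = ?col N" .
    have "measure_pmf.prob (?P N) {w. real N * e \<le>
          \<bar>last_passage (real_field w) (Suc (scaled N s)) (Suc (scaled N t)) - real N * (s * A + t * B)\<bar>} \<le>
        measure_pmf.prob (?P N) ({w. real N * (e / 2) \<le> \<bar>row_sum (real_field w) (scaled N s) - real N * (s * A)\<bar>} \<union>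
          {w. real N * (e / 2) \<le> \<bar>?inc w - real N * (t * B)\<bar>})"
    proof (rule measure_pmf.finite_measure_mono, rule subsetI)
      fix w assume "w \<in> {w. real N * e \<le>
          \<bar>last_passage (real_field w) (Suc (scaled N s)) (Suc (scaled N t)) - real N * (s * A + t * B)\<bar>}"
      then have "real N * (e / 2) + real N * (e / 2) \<le>
          \<bar>(row_sum (real_field w) (scaled N s) - real N * (s * A)) + (?inc w - real N * (t * B))\<bar>"
        by (simp add: algebra_simps del: last_passage.simps(3))
      then show "w \<in> {w. real N * (e / 2) \<le> \<bar>row_sum (real_field w) (scaled N s) - real N * (s * A)\<bar>} \<union>
          {w. real N * (e / 2) \<le> \<bar>?inc w - real N * (t * B)\<bar>}"
        unfolding Un_iff mem_Collect_eq by linarith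
    qed simp
    also have "\<dots> \<le> ?row N + ?col N"
      unfolding inc[symmetric] by (rule measure_Un_le) auto
    finally show "norm (measure_pmf.prob (?P N) {w. real N * e \<le>
          \<bar>last_passage (real_field w) (Suc (scaled N s)) (Suc (scaled N t)) - real N * (s * A + t * B)\<bar>}) \<le>
        ?row N + ?col N" by (simp del: last_passage.simps(3))
  qed
qed

text \<open>
  Adding boundary weights can only increase passage times.
\<close>
theorem quenched_upper_bound:
  assumes z: "admissible z A B" and s: "s > 0" and t: "t > 0" and e: "e > 0"
  shows "(\<lambda>N. measure (quenched_law a b)
    {W. last_passage W (scaled N s) (scaled N t) \<in> {real N * (s * A + t * B + e)..}}) \<longlonglongrightarrow> 0"
proof (rule Lim_null_comparison[OF _ stationary_passage_lln[OF z s t e]], intro always_eventually allI)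
  fix N
  have "w \<in> {w. real N * e \<le>
      \<bar>last_passage (real_field w) (Suc (scaled N s)) (Suc (scaled N t)) - real N * (s * A + t * B)\<bar>}"
    if w: "w \<in> set_pmf (stationary_pmf z a b (scaled N s) (scaled N t))"
      and G: "last_passage (bulk (real_field w)) (scaled N s) (scaled N t) \<in> {real N * (s * A + t * B + e)..}" for w
  proof -
    have "boundary_field (real_field w)" using stationary_support[OF w] by (simp add: boundary_field_def)
    from last_passage_bulk_le[OF this, of "scaled N s" "scaled N t"] G
    show ?thesis by (simp add: algebra_simps del: last_passage.simps(3))
  qed
  then show "norm (measure (quenched_law a b)
      {W. last_passage W (scaled N s) (scaled N t) \<in> {real N * (s * A + t * B + e)..}}) \<le>
    measure_pmf.prob (stationary_pmf z a b (scaled N s) (scaled N t)) {w. real N * e \<le>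
      \<bar>last_passage (real_field w) (Suc (scaled N s)) (Suc (scaled N t)) - real N * (s * A + t * B)\<bar>}"
    by (subst quenched_last_passage_prob[where z = z])
      (auto simp del: last_passage.simps(3) simp: AE_measure_pmf_iff intro!: measure_pmf.finite_measure_mono_AE)
qed

text \<open>
  If all seven quantities are close to their typical values, the two late alternatives of
  \<open>last_passage_exit_split\<close> fall short of \<open>G u\<close>, by hypothesis \<open>gaps\<close>.  So one of the early alternatives
  holds, and there the boundary accounts for at most \<open>N * e\<close> of the typical value \<open>N * F\<close>.
\<close>
lemma bulk_passage_lower:
  fixes N i j :: nat and u v w :: "nat \<times> nat \<Rightarrow> nat" and F F1 F2 A A1 B B2 \<rho> \<eta> e :: real
  defines "G \<equiv> \<lambda>w. last_passage (real_field w) (Suc i) (Suc j)"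
  assumes cpl: "\<And>x. coupled_at x (u x) (v x) (w x)"
    and zero: "u (0, 0) = 0" "v (0, 0) = 0" "w (0, 0) = 0"
    and gaps: "F1 - \<rho> * (A1 - A) + 4 * \<eta> \<le> F" "F2 - \<rho> * (B2 - B) + 4 * \<eta> \<le> F"
    and small: "\<rho> * A + 2 * \<eta> \<le> e" "\<rho> * B + 2 * \<eta> \<le> e"
    and dev: "\<bar>G u - N * F\<bar> < N * \<eta>" "\<bar>G v - N * F1\<bar> < N * \<eta>" "\<bar>G w - N * F2\<bar> < N * \<eta>"
      "\<bar>row_sum (real_field u) k - N * (\<rho> * A)\<bar> < N * \<eta>" "\<bar>row_sum (real_field v) k - N * (\<rho> * A1)\<bar> < N * \<eta>"
      "\<bar>col_sum (real_field u) k - N * (\<rho> * B)\<bar> < N * \<eta>" "\<bar>col_sum (real_field w) k - N * (\<rho> * B2)\<bar> < N * \<eta>"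
  shows "N * (F - e) \<le> last_passage (bulk (real_field u)) i j"
proof -
  let ?L = "last_passage (bulk (real_field u)) i j"
  have cpl': "u (Suc i, 0) \<le> v (Suc i, 0)" "u (0, Suc j) \<le> w (0, Suc j)"
    "v (Suc i, Suc j) = u (Suc i, Suc j)" "w (Suc i, Suc j) = u (Suc i, Suc j)" for i j
    using cpl[of "(Suc i, 0)"] cpl[of "(0, Suc j)"] cpl[of "(Suc i, Suc j)"] by (auto simp: coupled_at_def)
  have "G u \<le>
    max (max (row_sum (real_field u) k + ?L) (col_sum (real_field u) k + ?L))
        (max (G v - (row_sum (real_field v) k - row_sum (real_field u) k))
             (G w - (col_sum (real_field w) k - col_sum (real_field u) k)))"
    unfolding G_def by (rule last_passage_exit_split) (use zero cpl' in \<open>auto simp: boundary_field_def\<close>)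
  then consider "G u \<le> row_sum (real_field u) k + ?L" | "G u \<le> col_sum (real_field u) k + ?L"
    | "G u \<le> G v - (row_sum (real_field v) k - row_sum (real_field u) k)"
    | "G u \<le> G w - (col_sum (real_field w) k - col_sum (real_field u) k)"
    unfolding le_max_iff_disj by blast
  moreover have "N * (F1 - \<rho> * (A1 - A) + 4 * \<eta>) \<le> N * F" "N * (F2 - \<rho> * (B2 - B) + 4 * \<eta>) \<le> N * F"
    "N * (\<rho> * A + 2 * \<eta>) \<le> N * e" "N * (\<rho> * B + 2 * \<eta>) \<le> N * e"
    using gaps small by (auto intro!: mult_left_mono)
  then have "N * F1 - (N * (\<rho> * A1) - N * (\<rho> * A)) + 4 * (N * \<eta>) \<le> N * F"
    "N * F2 - (N * (\<rho> * B2) - N * (\<rho> * B)) + 4 * (N * \<eta>) \<le> N * F"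
    "N * (\<rho> * A) + 2 * (N * \<eta>) \<le> N * e" "N * (\<rho> * B) + 2 * (N * \<eta>) \<le> N * e"
    by (simp_all add: algebra_simps)
  moreover have "N * (F - e) = N * F - N * e" by (simp add: algebra_simps)
  ultimately show ?thesis using dev by cases linarith+
qed

text \<open>
  A coupling of the stationary models for \<open>z1 < z < z2\<close> transfers the laws of large numbers for boundary
  sums and passage times, each of which concerns one model only, to a lower bound for the shared bulk.
\<close>
theorem quenched_lower_bound:
  assumes z: "admissible z A B" "admissible z1 A1 B1" "admissible z2 A2 B2" and less: "z1 < z" "z < z2"
    and pos: "0 < \<rho>" "\<rho> \<le> s" "\<rho> \<le> t" "0 < \<eta>"
    and gaps: "s * A1 + t * B1 - \<rho> * (A1 - A) + 4 * \<eta> \<le> s * A + t * B"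
      "s * A2 + t * B2 - \<rho> * (B2 - B) + 4 * \<eta> \<le> s * A + t * B"
    and small: "\<rho> * A + 2 * \<eta> \<le> e" "\<rho> * B + 2 * \<eta> \<le> e"
  shows "(\<lambda>N. measure (quenched_law a b)
    {W. last_passage W (scaled N s) (scaled N t) \<in> {..<real N * (s * A + t * B - e)}}) \<longlonglongrightarrow> 0"
proof -
  let ?P = "\<lambda>z N. stationary_pmf z a b (scaled N s) (scaled N t)"
  let ?G = "\<lambda>N w. last_passage (real_field w) (Suc (scaled N s)) (Suc (scaled N t))"
  let ?r = "\<lambda>N w. row_sum (real_field w) (scaled N \<rho>)" and ?c = "\<lambda>N w. col_sum (real_field w) (scaled N \<rho>)"
  let ?D = "\<lambda>N f c. {w. real N * \<eta> \<le> \<bar>f N w - real N * c\<bar>}"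
  have st: "s > 0" "t > 0" using pos by auto
  have le: "scaled N \<rho> \<le> scaled N s" "scaled N \<rho> \<le> scaled N t" for N
    using pos by (auto intro!: nat_mono floor_mono mult_left_mono)
  define p where "p N = measure_pmf.prob (?P z N) (?D N ?G (s * A + t * B)) +
    measure_pmf.prob (?P z1 N) (?D N ?G (s * A1 + t * B1)) +
    measure_pmf.prob (?P z2 N) (?D N ?G (s * A2 + t * B2)) +
    measure_pmf.prob (?P z N) (?D N ?r (\<rho> * A)) + measure_pmf.prob (?P z1 N) (?D N ?r (\<rho> * A1)) +
    measure_pmf.prob (?P z N) (?D N ?c (\<rho> * B)) + measure_pmf.prob (?P z2 N) (?D N ?c (\<rho> * B2))" for N
  have "p \<longlonglongrightarrow> 0"
    unfolding p_def
    by (intro tendsto_add_zero stationary_passage_lln[OF z(1)] stationary_passage_lln[OF z(2)]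
        stationary_passage_lln[OF z(3)] row_sum_lln[OF z(1)] row_sum_lln[OF z(2)]
        col_sum_lln[OF z(1)] col_sum_lln[OF z(3)] st pos le)
  then show ?thesis
  proof (rule Lim_null_comparison[rotated], intro always_eventually allI)
    fix N
    obtain c where c: "map_pmf fst c = ?P z N" "map_pmf (fst \<circ> snd) c = ?P z1 N"
        "map_pmf (snd \<circ> snd) c = ?P z2 N"
      and cpl: "\<And>u v w x. (u, v, w) \<in> set_pmf c \<Longrightarrow> coupled_at x (u x) (v x) (w x)"
      using stationary_coupling[OF admissible_subcritical[OF z(1)] admissible_subcritical[OF z(2)]
        admissible_subcritical[OF z(3)] less, of "scaled N s" "scaled N t"] by metis
    let ?bad = "{(u, v, w). u \<in> ?D N ?G (s * A + t * B) \<or> v \<in> ?D N ?G (s * A1 + t * B1) \<or>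
        w \<in> ?D N ?G (s * A2 + t * B2) \<or> u \<in> ?D N ?r (\<rho> * A) \<or> v \<in> ?D N ?r (\<rho> * A1) \<or>
        u \<in> ?D N ?c (\<rho> * B) \<or> w \<in> ?D N ?c (\<rho> * B2)}"
    let ?low = "{w. last_passage (bulk (real_field w)) (scaled N s) (scaled N t) \<in> {..<real N * (s * A + t * B - e)}}"
    have "measure (quenched_law a b)
        {W. last_passage W (scaled N s) (scaled N t) \<in> {..<real N * (s * A + t * B - e)}} =
        measure_pmf.prob (map_pmf fst c) ?low"
      unfolding c(1) by (rule quenched_last_passage_prob) simp
    also have "\<dots> = measure_pmf.prob c (fst -` ?low)" by (rule measure_map_pmf)
    also have "\<dots> \<le> measure_pmf.prob c ?bad"
    proof (rule measure_pmf.finite_measure_mono_AE)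
      show "AE x in c. x \<in> fst -` ?low \<longrightarrow> x \<in> ?bad"
        unfolding AE_measure_pmf_iff
      proof (intro ballI impI, rule ccontr)
        fix x assume x: "x \<in> set_pmf c" "x \<in> fst -` ?low" "x \<notin> ?bad"
        obtain u v w where uvw: "x = (u, v, w)" by (cases x) auto
        have "u \<in> set_pmf (map_pmf fst c)" "v \<in> set_pmf (map_pmf (fst \<circ> snd) c)" "w \<in> set_pmf (map_pmf (snd \<circ> snd) c)"
          using x(1) by (force simp: uvw)+
        then have zero: "u (0, 0) = 0" "v (0, 0) = 0" "w (0, 0) = 0"
          unfolding c by (auto dest: stationary_support)
        have cpl': "coupled_at y (u y) (v y) (w y)" for y
          using cpl x(1) by (simp add: uvw)
        \<comment> \<open>Outside the bad event every quantity is within \<open>N * \<eta>\<close> of its typical value.\<close>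
        have "real N * (s * A + t * B - e) \<le> last_passage (bulk (real_field u)) (scaled N s) (scaled N t)"
          by (rule bulk_passage_lower[where u = u and v = v and w = w, OF cpl' zero gaps small])
            (use x(3) in \<open>auto simp: uvw not_le simp del: last_passage.simps(3)\<close>)
        then show False using x(2) by (simp add: uvw)
      qed
    qed simp
    also have "\<dots> \<le> p N"
      unfolding p_def c[symmetric] by (rule prob_triple_union)
    finally show "norm (measure (quenched_law a b)
      {W. last_passage W (scaled N s) (scaled N t) \<in> {..<real N * (s * A + t * B - e)}}) \<le> p N" by simp
  qed
qed

end

lemma prob_tendsto_1_if_eventually:
  assumes M: "prob_space M" and E: "\<And>N. E N \<in> sets M"
    and ev: "AE x in M. \<forall>\<^sub>F N in sequentially. x \<in> E N"
  shows "(\<lambda>N. measure M (E N)) \<longlonglongrightarrow> 1"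
proof -
  interpret prob_space M by fact
  have "(\<lambda>N. \<integral>x. indicator (E N) x \<partial>M) \<longlonglongrightarrow> (\<integral>x. (1::real) \<partial>M)"
  proof (rule integral_dominated_convergence[where w = "\<lambda>_. 1"])
    show "AE x in M. (\<lambda>N. indicator (E N) x :: real) \<longlonglongrightarrow> 1"
      using ev by eventually_elim (rule tendsto_eventually, auto elim!: eventually_mono)
    show "AE x in M. norm (indicator (E N) x :: real) \<le> 1" for N by (auto simp: indicator_def)
  qed (use E in auto)
  moreover have "(\<integral>x. indicator (E N) x \<partial>M) = measure M (E N)" for N
    using E[of N] sets.sets_into_space[OF E[of N]] by (simp add: Int_absorb2)
  ultimately show ?thesis by (simp add: prob_space)
qed

lemma measurable_last_passage_quenched:
  "(\<lambda>W. last_passage W m n) \<in> borel_measurable (quenched_law a b)"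
proof -
  have "(\<lambda>W. last_passage (restrict W ({..<m} \<times> {..<n})) m n) \<in> borel_measurable (quenched_law a b)"
    by (rule measurable_compose[OF _ measurable_last_passage_PiM[OF order_refl order_refl]])
      (subst measurable_cong_sets[OF sets_quenched_law refl], rule measurable_restrict_subset, simp)
  moreover have "last_passage (restrict W ({..<m} \<times> {..<n})) m n = last_passage W m n" for W
    by (rule last_passage_cong) auto
  ultimately show ?thesis by simp
qed

context corner_environment
begin

lemma quenched_shape_le:
  assumes conv: "AE W in quenched_law a b. (\<lambda>N. ereal (last_passage W (scaled N s) (scaled N t) / real N)) \<longlonglongrightarrow> \<gamma>"
    and z: "admissible z A B" and s: "s > 0" and t: "t > 0" and e: "e > 0"
  shows "\<gamma> \<le> ereal (s * A + t * B + e)"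
proof (rule ccontr)
  let ?c = "s * A + t * B + e"
  let ?E = "\<lambda>N. {W. last_passage W (scaled N s) (scaled N t) \<in> {real N * ?c..}}"
  assume "\<not> \<gamma> \<le> ereal ?c"
  then have less: "ereal ?c < \<gamma>" by simp
  have "?E N = (\<lambda>W. last_passage W (scaled N s) (scaled N t)) -` {real N * ?c..} \<inter> space (quenched_law a b)" for N
    by auto
  then have E: "?E N \<in> sets (quenched_law a b)" for N
    by (simp only: measurable_sets[OF measurable_last_passage_quenched] atLeast_borel)
  have "AE W in quenched_law a b. \<forall>\<^sub>F N in sequentially. W \<in> ?E N"
    using conv
  proof eventually_elim
    case (elim W)
    from order_tendstoD(1)[OF elim less] eventually_gt_at_top[of 0]
    show ?case by eventually_elim (simp add: field_simps)
  qed
  then have "(\<lambda>N. measure (quenched_law a b) (?E N)) \<longlonglongrightarrow> 1"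
    by (rule prob_tendsto_1_if_eventually[OF prob_space_quenched_law E])
  then show False
    using LIMSEQ_unique[OF quenched_upper_bound[OF z s t e]] by fastforce
qed

lemma quenched_shape_ge:
  assumes conv: "AE W in quenched_law a b. (\<lambda>N. ereal (last_passage W (scaled N s) (scaled N t) / real N)) \<longlonglongrightarrow> \<gamma>"
    and low: "(\<lambda>N. measure (quenched_law a b) {W. last_passage W (scaled N s) (scaled N t) \<in> {..<real N * c}}) \<longlonglongrightarrow> 0"
  shows "ereal c \<le> \<gamma>"
proof (rule ccontr)
  let ?E = "\<lambda>N. {W. last_passage W (scaled N s) (scaled N t) \<in> {..<real N * c}}"
  assume "\<not> ereal c \<le> \<gamma>"
  then have less: "\<gamma> < ereal c" by simp
  have "?E N = (\<lambda>W. last_passage W (scaled N s) (scaled N t)) -` {..<real N * c} \<inter> space (quenched_law a b)" for N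
    by auto
  then have E: "?E N \<in> sets (quenched_law a b)" for N
    by (simp only: measurable_sets[OF measurable_last_passage_quenched] lessThan_borel)
  have "AE W in quenched_law a b. \<forall>\<^sub>F N in sequentially. W \<in> ?E N"
    using conv
  proof eventually_elim
    case (elim W)
    from order_tendstoD(2)[OF elim less] eventually_gt_at_top[of 0]
    show ?case by eventually_elim (simp add: field_simps)
  qed
  then have "(\<lambda>N. measure (quenched_law a b) (?E N)) \<longlonglongrightarrow> 1"
    by (rule prob_tendsto_1_if_eventually[OF prob_space_quenched_law E])
  then show False
    using LIMSEQ_unique[OF low] by fastforce
qed

end

section \<open>The shape function at a critical point\<close>

lemma measurable_env_coordinate:
  assumes "sets \<mu> = sets env_space"
  shows "(\<lambda>e. fst e i) \<in> borel_measurable \<mu>" "(\<lambda>e. snd e i) \<in> borel_measurable \<mu>"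
proof -
  have "(\<lambda>c. c i) \<in> (\<Pi>\<^sub>M n\<in>UNIV. restrict_space borel {0<..<1 :: real}) \<rightarrow>\<^sub>M restrict_space borel {0<..<1 :: real}"
    for i :: nat
    by measurable
  then have coord: "(\<lambda>c. c i) \<in> borel_measurable (\<Pi>\<^sub>M n\<in>UNIV. restrict_space borel {0<..<1 :: real})" for i :: nat
    by (simp add: measurable_restrict_space2_iff)
  show "(\<lambda>e. fst e i) \<in> borel_measurable \<mu>" "(\<lambda>e. snd e i) \<in> borel_measurable \<mu>"
    unfolding measurable_cong_sets[OF assms refl] env_space_def
    by (rule measurable_compose[OF measurable_fst coord], rule measurable_compose[OF measurable_snd coord])
qed

lemma env_range:
  assumes "sets \<mu> = sets env_space" "e \<in> space \<mu>"
  shows "0 < fst e i" "fst e i < 1" "0 < snd e i" "snd e i < 1"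
  using assms(2) unfolding sets_eq_imp_space_eq[OF assms(1)]
  by (auto simp: env_space_def space_pair_measure space_PiM space_restrict_space PiE_iff)

text \<open>
  A null set of the mixture is a null set of almost every component.
\<close>
lemma AE_quenched_if_AE_annealed:
  assumes env: "environment \<mu>" and P: "AE W in annealed_law \<mu>. P W"
  shows "AE e in \<mu>. AE W in quenched_law (fst e) (snd e). P W"
proof -
  have pr: "prob_space \<mu>" and st: "sets \<mu> = sets env_space" using env by (auto simp: environment_def)
  let ?L = "\<Pi>\<^sub>M (ij :: nat \<times> nat)\<in>UNIV. (borel :: real measure)"
  let ?K = "\<lambda>(a, b). quenched_law a b"
  have mu: "\<mu> \<in> space (prob_algebra env_space)" using pr st by (simp add: space_prob_algebra)
  from P obtain Z where Z: "{W \<in> space (annealed_law \<mu>). \<not> P W} \<subseteq> Z" "emeasure (annealed_law \<mu>) Z = 0"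
      "Z \<in> sets (annealed_law \<mu>)"
    by (rule AE_E)
  have sets: "sets (annealed_law \<mu>) = sets ?L"
    unfolding annealed_law_def by (rule sets_bind'[OF mu measurable_quenched_law])
  then have Zs: "Z \<in> sets ?L" using Z(3) by simp
  have sp: "space (annealed_law \<mu>) = UNIV" using sets_eq_imp_space_eq[OF sets] by (simp add: space_PiM)
  have K: "?K \<in> env_space \<rightarrow>\<^sub>M subprob_algebra ?L"
    by (rule measurable_prob_algebraD[OF measurable_quenched_law])
  have "(\<integral>\<^sup>+e. emeasure (?K e) Z \<partial>\<mu>) = 0"
    using Z(2) unfolding annealed_law_def
    by (simp only: emeasure_bind_prob_algebra[OF mu measurable_quenched_law Zs])
  moreover have "(\<lambda>e. emeasure (?K e) Z) \<in> borel_measurable \<mu>"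
    unfolding measurable_cong_sets[OF st refl] by (rule measurable_emeasure_kernel[OF K Zs])
  ultimately have "AE e in \<mu>. emeasure (?K e) Z = 0"
    by (simp add: nn_integral_0_iff_AE)
  then show ?thesis
  proof eventually_elim
    case (elim e)
    then show ?case
      using Z(1) Zs by (intro AE_I[of _ _ Z]) (auto simp: sp case_prod_beta sets_quenched_law)
  qed
qed

abbreviation env_shift :: "(nat \<Rightarrow> real) \<times> (nat \<Rightarrow> real) \<Rightarrow> (nat \<Rightarrow> real) \<times> (nat \<Rightarrow> real)" where
  "env_shift \<equiv> map_prod (shift 1) (shift 1)"

lemma env_shift_funpow: "(env_shift ^^ i) e = (shift i (fst e), shift i (snd e))"
  by (induction i) (auto simp: shift_def fun_eq_iff)

lemma env_shift_ergodic: "environment \<mu> \<Longrightarrow> ergodic_map \<mu> env_shift"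
  unfolding environment_def by blast

lemma AE_iterates:
  assumes T: "T \<in> M \<rightarrow>\<^sub>M M" "distr M M T = M" and P: "AE x in M. P x" and Pm: "{x \<in> space M. P x} \<in> sets M"
  shows "AE x in M. \<forall>i. P ((T ^^ i) x)"
proof -
  have "AE x in M. P ((T ^^ i) x)" for i
  proof (induction i)
    case (Suc i)
    have m: "T ^^ i \<in> M \<rightarrow>\<^sub>M M" by (induction i) (use T(1) in auto)
    have "{x \<in> space M. P ((T ^^ i) x)} = (T ^^ i) -` {x \<in> space M. P x} \<inter> space M"
      using measurable_space[OF m] by auto
    then have "{x \<in> space M. P ((T ^^ i) x)} \<in> sets M" using measurable_sets[OF m Pm] by simp
    from AE_distr_iff[OF T(1) this] Suc show ?case unfolding T(2) by (simp add: funpow_swap1)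
  qed (use P in simp)
  then show ?thesis by (simp add: AE_all_countable)
qed

lemma environment_average:
  fixes f :: "real \<Rightarrow> real"
  assumes env: "environment \<mu>" and X: "X \<in> borel_measurable \<mu>"
    and f: "integrable (distr \<mu> borel X) f"
  shows "AE e in \<mu>. (\<lambda>n. (\<Sum>i<n. f (X ((env_shift ^^ i) e))) / real n) \<longlonglongrightarrow> (\<integral>x. f x \<partial>distr \<mu> borel X)"
proof -
  have "integrable \<mu> (\<lambda>e. f (X e))" by (rule integrable_distr[OF X f])
  from birkhoff_ergodic[OF env_shift_ergodic[OF env] this]
  show ?thesis using f by (simp add: birkhoff_sum_def integral_distr[OF X])
qed

text \<open>
  Write \<open>F z = s * A z + t * B z\<close>.  The upper bound \<open>F z\<close> holds for every parameter.  For the lower bound at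
  the critical point, the derivative of \<open>F - \<rho> * A\<close> at \<open>z\<close> is \<open>- \<rho> * A' > 0\<close>, so a slightly smaller
  parameter \<open>z1\<close> has \<open>F z1 - \<rho> * A z1 < F z - \<rho> * A z\<close>.  This says that paths which follow the horizontal
  axis for a distance of at least \<open>\<rho> * N\<close> are not optimal; a slightly larger \<open>z2\<close> excludes the vertical
  axis.  The remaining paths spend a negligible time on the boundary as \<open>\<rho>\<close> tends to \<open>0\<close>.
\<close>
theorem shape_at_critical_point:
  assumes env: "environment \<mu>" and shape: "is_shape_function \<mu> g"
    and \<sigma>: "\<sigma> < 1"
    and a: "AE x in a_law \<mu>. x \<le> \<sigma>" and b: "AE x in b_law \<mu>. x \<le> \<sigma>"
    and A: "\<And>z. \<sigma> < z \<Longrightarrow> z * \<sigma> < 1 \<Longrightarrow> has_bochner_integral (a_law \<mu>) (\<lambda>x. x / (z - x)) (A z)"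
    and B: "\<And>z. \<sigma> < z \<Longrightarrow> z * \<sigma> < 1 \<Longrightarrow> has_bochner_integral (b_law \<mu>) (\<lambda>x. z * x / (1 - z * x)) (B z)"
    and z: "\<sigma> < z" "z * \<sigma> < 1"
    and DA: "(A has_real_derivative A') (at z)" "A' < 0"
    and DB: "(B has_real_derivative B') (at z)" "B' > 0"
    and crit: "s * A' + t * B' = 0" and s: "s > 0" and t: "t > 0"
  shows "g s t = ereal (s * A z + t * B z)"
proof -
  have pr: "prob_space \<mu>" and st: "sets \<mu> = sets env_space" using env by (auto simp: environment_def)
  interpret prob_space \<mu> by fact
  note coord[measurable] = measurable_env_coordinate[OF st]
  have a_law: "a_law \<mu> = distr \<mu> borel (\<lambda>e. fst e 0)" and b_law: "b_law \<mu> = distr \<mu> borel (\<lambda>e. snd e 0)"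
    by (simp_all add: a_law_def b_law_def case_prod_unfold)
  have \<sigma>0: "0 < \<sigma>"
  proof -
    have "AE e in \<mu>. fst e 0 \<le> \<sigma>" using a unfolding a_law by (subst (asm) AE_distr_iff) auto
    then have "AE e in \<mu>. 0 < \<sigma>" using AE_space
      by eventually_elim (use env_range(1)[OF st] in \<open>meson less_le_trans\<close>)
    then show ?thesis by simp
  qed
  have bound: "AE e in \<mu>. (\<forall>i. fst e i \<le> \<sigma>) \<and> (\<forall>i. snd e i \<le> \<sigma>)"
  proof -
    have "AE e in \<mu>. fst e 0 \<le> \<sigma>" using a unfolding a_law by (subst (asm) AE_distr_iff) auto
    moreover have "AE e in \<mu>. snd e 0 \<le> \<sigma>" using b unfolding b_law by (subst (asm) AE_distr_iff) auto
    ultimately have "AE e in \<mu>. fst e 0 \<le> \<sigma> \<and> snd e 0 \<le> \<sigma>" by eventually_elim simp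
    then have "AE e in \<mu>. \<forall>i. fst ((env_shift ^^ i) e) 0 \<le> \<sigma> \<and> snd ((env_shift ^^ i) e) 0 \<le> \<sigma>"
      by (rule AE_iterates[OF ergodic_mapD(2,3)[OF env_shift_ergodic[OF env]]]) measurable
    then show ?thesis
      unfolding env_shift_funpow by eventually_elim (simp add: shift_def)
  qed
  have avg: "AE e in \<mu>. corner_environment.admissible (fst e) (snd e) \<sigma> z (A z) (B z)"
    if z: "\<sigma> < z" "z * \<sigma> < 1" for z
  proof -
    have iA: "integrable (a_law \<mu>) (\<lambda>x. x / (z - x))" "(\<integral>x. x / (z - x) \<partial>a_law \<mu>) = A z"
      using A[OF z] by (auto simp: has_bochner_integral_iff)
    have iB: "integrable (b_law \<mu>) (\<lambda>x. z * x / (1 - z * x))" "(\<integral>x. z * x / (1 - z * x) \<partial>b_law \<mu>) = B z"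
      using B[OF z] by (auto simp: has_bochner_integral_iff)
    show ?thesis
      using bound AE_space environment_average[OF env coord(1) iA(1)[unfolded a_law]]
        environment_average[OF env coord(2) iB(1)[unfolded b_law]]
    proof eventually_elim
      case (elim e)
      interpret corner_environment "fst e" "snd e" \<sigma>
        by unfold_locales (use elim env_range[OF st] \<sigma> in auto)
      show ?case
        using elim(3,4) z unfolding admissible_def a_law[symmetric] b_law[symmetric] iA iB env_shift_funpow
        by (simp add: shift_def)
    qed
  qed
  have conv: "AE e in \<mu>. AE W in quenched_law (fst e) (snd e).
      (\<lambda>n. ereal (last_passage W (scaled n s) (scaled n t) / real n)) \<longlonglongrightarrow> g s t"
  proof (rule AE_quenched_if_AE_annealed[OF env])
    show "AE W in annealed_law \<mu>. (\<lambda>n. ereal (last_passage W (scaled n s) (scaled n t) / real n)) \<longlonglongrightarrow> g s t"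
      using shape unfolding is_shape_function_def by eventually_elim (use s t in auto)
  qed
  let ?F = "\<lambda>z. s * A z + t * B z"
  have bounds: "ereal (?F z - e) \<le> g s t \<and> g s t \<le> ereal (?F z + e)" if e: "e > 0" for e
  proof -
    \<comment> \<open>A boundary stretch of length \<open>\<rho> * N\<close> carries a mean weight of at most \<open>N * e / 2\<close> on either axis.\<close>
    define \<rho> where "\<rho> = min (min s t) (e / (2 * (\<bar>A z\<bar> + \<bar>B z\<bar> + 1)))"
    have \<rho>: "0 < \<rho>" "\<rho> \<le> s" "\<rho> \<le> t" using s t e by (auto simp: \<rho>_def intro!: divide_pos_pos)
    have "\<rho> * (\<bar>A z\<bar> + \<bar>B z\<bar> + 1) \<le> e / (2 * (\<bar>A z\<bar> + \<bar>B z\<bar> + 1)) * (\<bar>A z\<bar> + \<bar>B z\<bar> + 1)"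
      by (intro mult_right_mono) (auto simp: \<rho>_def)
    also have "\<dots> = e / 2" by (simp add: field_simps)
    finally have \<rho>e: "\<rho> * (\<bar>A z\<bar> + \<bar>B z\<bar> + 1) \<le> e / 2" .
    have "\<rho> * A z \<le> \<rho> * (\<bar>A z\<bar> + \<bar>B z\<bar> + 1)" "\<rho> * B z \<le> \<rho> * (\<bar>A z\<bar> + \<bar>B z\<bar> + 1)"
      using \<rho>(1) by (intro mult_left_mono; linarith)+
    then have small: "\<rho> * A z \<le> e / 2" "\<rho> * B z \<le> e / 2"
      using \<rho>e by linarith+
    have "DERIV (\<lambda>z. ?F z - \<rho> * A z) z :> s * A' + t * B' - \<rho> * A'"
      by (intro DERIV_diff DERIV_add DERIV_cmult DA DB)
    moreover have "0 < s * A' + t * B' - \<rho> * A'" using crit \<rho> DA by (simp add: mult_pos_neg)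
    ultimately obtain d1 where d1: "d1 > 0" "\<And>h. 0 < h \<Longrightarrow> h < d1 \<Longrightarrow> ?F (z - h) - \<rho> * A (z - h) < ?F z - \<rho> * A z"
      using DERIV_pos_inc_left by blast
    have "DERIV (\<lambda>z. ?F z - \<rho> * B z) z :> s * A' + t * B' - \<rho> * B'"
      by (intro DERIV_diff DERIV_add DERIV_cmult DA DB)
    moreover have "s * A' + t * B' - \<rho> * B' < 0" using crit \<rho> DB by simp
    ultimately obtain d2 where d2: "d2 > 0" "\<And>h. 0 < h \<Longrightarrow> h < d2 \<Longrightarrow> ?F (z + h) - \<rho> * B (z + h) < ?F z - \<rho> * B z"
      using DERIV_neg_dec_right by blast
    define h1 where "h1 = min d1 (z - \<sigma>) / 2"
    define h2 where "h2 = min d2 (1 / \<sigma> - z) / 2"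
    have zs: "z < 1 / \<sigma>" using z \<sigma>0 by (simp add: field_simps)
    have h1': "0 < h1" "2 * h1 \<le> d1" "2 * h1 \<le> z - \<sigma>" using d1(1) z by (simp_all add: h1_def)
    have h1: "0 < h1" "h1 < d1" using h1'(1,2) by linarith+
    have "\<sigma> < z - h1" using h1'(1,3) by linarith
    note h1 = h1 this
    have h2': "0 < h2" "2 * h2 \<le> d2" "2 * h2 \<le> 1 / \<sigma> - z" using d2(1) zs by (simp_all add: h2_def)
    have h2: "0 < h2" "h2 < d2" using h2'(1,2) by linarith+
    have "z + h2 < 1 / \<sigma>" using h2'(1,3) by linarith
    note h2 = h2 this
    define z1 where "z1 = z - h1"
    define z2 where "z2 = z + h2"
    have z12: "\<sigma> < z1" "z1 < z" "z < z2" "z2 < 1 / \<sigma>" using h1 h2 by (auto simp: z1_def z2_def)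
    have adm: "\<sigma> < z1" "z1 * \<sigma> < 1" "\<sigma> < z2" "z2 * \<sigma> < 1"
    proof -
      show "z1 * \<sigma> < 1" using mult_strict_right_mono[OF z12(2) \<sigma>0] z(2) by linarith
      show "z2 * \<sigma> < 1" using z12(4) \<sigma>0 by (simp add: field_simps)
    qed (use z12 in linarith)+
    define gap1 where "gap1 = (?F z - \<rho> * A z) - (?F z1 - \<rho> * A z1)"
    define gap2 where "gap2 = (?F z - \<rho> * B z) - (?F z2 - \<rho> * B z2)"
    have gap: "0 < gap1" "0 < gap2"
      using d1(2)[OF h1(1,2)] d2(2)[OF h2(1,2)] by (auto simp: gap1_def gap2_def z1_def z2_def)
    \<comment> \<open>The total deviation \<open>4 * \<eta>\<close> fits into both gaps.\<close>
    define \<eta> where "\<eta> = min e (min gap1 gap2) / 4"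
    have \<eta>: "0 < \<eta>" "4 * \<eta> \<le> gap1" "4 * \<eta> \<le> gap2" "4 * \<eta> \<le> e" using gap e by (auto simp: \<eta>_def)
    have "AE e in \<mu>. ((\<forall>i. fst e i \<le> \<sigma>) \<and> (\<forall>i. snd e i \<le> \<sigma>)) \<and> e \<in> space \<mu> \<and>
        corner_environment.admissible (fst e) (snd e) \<sigma> z (A z) (B z) \<and>
        corner_environment.admissible (fst e) (snd e) \<sigma> z1 (A z1) (B z1) \<and>
        corner_environment.admissible (fst e) (snd e) \<sigma> z2 (A z2) (B z2) \<and>
        (AE W in quenched_law (fst e) (snd e).
          (\<lambda>n. ereal (last_passage W (scaled n s) (scaled n t) / real n)) \<longlonglongrightarrow> g s t)"
      using bound AE_space avg[OF z] avg[OF adm(1,2)] avg[OF adm(3,4)] conv by eventually_elim simp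
    then obtain e' where e': "\<And>i. fst e' i \<le> \<sigma>" "\<And>i. snd e' i \<le> \<sigma>" "e' \<in> space \<mu>"
      "corner_environment.admissible (fst e') (snd e') \<sigma> z (A z) (B z)"
      "corner_environment.admissible (fst e') (snd e') \<sigma> z1 (A z1) (B z1)"
      "corner_environment.admissible (fst e') (snd e') \<sigma> z2 (A z2) (B z2)"
      "AE W in quenched_law (fst e') (snd e').
          (\<lambda>n. ereal (last_passage W (scaled n s) (scaled n t) / real n)) \<longlonglongrightarrow> g s t"
      using eventually_happens'[OF ae_filter_bot] by blast
    interpret corner_environment "fst e'" "snd e'" \<sigma>
      by unfold_locales (use e'(1,2) env_range[OF st e'(3)] \<sigma> in auto)
    have "g s t \<le> ereal (?F z + e)"
      by (rule quenched_shape_le[OF e'(7,4) s t e])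
    moreover have "ereal (?F z - e) \<le> g s t"
    proof (rule quenched_shape_ge[OF e'(7) quenched_lower_bound[OF e'(4,5,6) z12(2,3) \<rho> \<eta>(1)]])
      show "s * A z1 + t * B z1 - \<rho> * (A z1 - A z) + 4 * \<eta> \<le> s * A z + t * B z"
        using \<eta>(2) unfolding gap1_def by (simp add: algebra_simps)
      show "s * A z2 + t * B z2 - \<rho> * (B z2 - B z) + 4 * \<eta> \<le> s * A z + t * B z"
        using \<eta>(3) unfolding gap2_def by (simp add: algebra_simps)
      show "\<rho> * A z + 2 * \<eta> \<le> e" "\<rho> * B z + 2 * \<eta> \<le> e"
        using \<eta>(4) small by simp_all
    qed
    ultimately show ?thesis by simp
  qed
  show ?thesis
  proof (rule antisym)
    show "g s t \<le> ereal (?F z)"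
      by (rule ereal_le_epsilon2) (use bounds in simp)
    show "ereal (?F z) \<le> g s t"
    proof (rule ereal_le_epsilon2)
      fix e :: real assume "0 < e"
      then have "ereal (?F z - e) \<le> g s t" using bounds by blast
      then have "ereal (?F z - e) + ereal e \<le> g s t + ereal e" by (rule add_right_mono)
      then show "ereal (?F z) \<le> g s t + ereal e" by simp
    qed
  qed
qed

section \<open>Densities proportional to the reciprocal\<close>

text \<open>
  The case \<open>f = 1\<close>, \<open>F = ln\<close> identifies the normalizing constant of the density.
\<close>
lemma reciprocal_density_integral:
  fixes f F :: "real \<Rightarrow> real"
  assumes \<nu>: "prob_space \<nu>" "has_density_proportional_to \<nu> (\<lambda>x. 1 / x) {lo..hi}"
    and lo: "0 < lo" "lo < hi" and f: "f \<in> borel_measurable borel"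
    and F: "\<And>x. lo \<le> x \<Longrightarrow> x \<le> hi \<Longrightarrow> (F has_real_derivative f x / x) (at x)"
    and cont: "continuous_on {lo..hi} (\<lambda>x. f x / x)"
  shows "has_bochner_integral \<nu> f ((F hi - F lo) / ln (hi / lo))"
proof -
  obtain c where c: "c > 0" "\<nu> = density lborel (\<lambda>x. ennreal (c * (1 / x) * indicator {lo..hi} x))"
    using \<nu>(2) by (auto simp: has_density_proportional_to_def)
  let ?d = "\<lambda>x. c * (1 / x) * indicator {lo..hi} x :: real"
  have main: "has_bochner_integral \<nu> h (c * (H hi - H lo))"
    if h: "h \<in> borel_measurable borel" and H: "\<And>x. lo \<le> x \<Longrightarrow> x \<le> hi \<Longrightarrow> (H has_real_derivative h x / x) (at x)"
      and ct: "continuous_on {lo..hi} (\<lambda>x. h x / x)" for h H :: "real \<Rightarrow> real"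
  proof -
    have "has_bochner_integral lborel (\<lambda>x. indicator {lo..hi} x *\<^sub>R (h x / x)) (H hi - H lo)"
      using lo by (intro has_bochner_integral_FTC_Icc ct)
        (auto intro!: has_vector_derivative_at_within H[THEN has_field_derivative_at_within]
          simp: has_real_derivative_iff_has_vector_derivative[symmetric])
    then have "has_bochner_integral lborel (\<lambda>x. c *\<^sub>R (indicator {lo..hi} x *\<^sub>R (h x / x))) (c *\<^sub>R (H hi - H lo))"
      by (rule has_bochner_integral_scaleR_right)
    also have "(\<lambda>x. c *\<^sub>R (indicator {lo..hi} x *\<^sub>R (h x / x))) = (\<lambda>x. ?d x *\<^sub>R h x)"
      by (auto simp: fun_eq_iff)
    finally have "has_bochner_integral lborel (\<lambda>x. ?d x *\<^sub>R h x) (c * (H hi - H lo))" by simp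
    moreover have "AE x in lborel. 0 \<le> ?d x" using c lo by (auto simp: indicator_def)
    ultimately show ?thesis
      unfolding c(2) using h by (intro has_bochner_integral_density) auto
  qed
  have "has_bochner_integral \<nu> (\<lambda>_. 1) (c * (ln hi - ln lo))"
    using lo by (intro main) (auto intro!: derivative_eq_intros continuous_intros)
  then have "c * (ln hi - ln lo) = 1"
    using prob_space.prob_space[OF \<nu>(1)] by (simp add: has_bochner_integral_iff)
  moreover have "ln hi - ln lo = ln (hi / lo)" using lo by (simp add: ln_div)
  ultimately have "c * ln (hi / lo) = 1" by (simp only:)
  moreover have "ln (hi / lo) \<noteq> 0" using lo by simp
  ultimately have "c = 1 / ln (hi / lo)" by (simp add: eq_divide_eq)
  with main[OF f F cont] show ?thesis by simp
qed

lemma reciprocal_density_support: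
  assumes "has_density_proportional_to \<nu> f {lo..hi}" "f \<in> borel_measurable borel"
  shows "AE x in \<nu>. x \<le> hi"
proof -
  obtain c where c: "\<nu> = density lborel (\<lambda>x. ennreal (c * f x * indicator {lo..hi} x))"
    using assms(1) by (auto simp: has_density_proportional_to_def)
  show ?thesis
    unfolding c using assms(2) by (subst AE_density) (auto simp: indicator_def)
qed

text \<open>
  The substitution \<open>u = (1 - z * \<sigma>) / (z - \<sigma>)\<close> maps the admissible parameters \<open>\<sigma> < z < 1 / \<sigma>\<close> onto the
  positive half-line, makes the arguments of both logarithms linear in \<open>u\<close> and \<open>1 / u\<close>, and turns the
  condition for a critical point into the quadratic equation \<open>quad\<close>.
\<close>
lemma critical_point:
  fixes \<sigma> l m s t L M :: real
  assumes \<sigma>: "0 < \<sigma>" "\<sigma> < 1" and l: "0 < l" "l < \<sigma>" and m: "0 < m" "m < \<sigma>"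
    and st: "0 < s" "0 < t" and LM: "0 < L" "0 < M" and u: "0 < u"
    and quad: "s * l * M * (1 + m * \<sigma> - \<sigma>\<^sup>2) * u\<^sup>2 + (m * (s * l * M) - l * (t * m * L)) * u =
      t * m * L * (1 + l * \<sigma> - \<sigma>\<^sup>2)"
  defines "z \<equiv> (1 + u * \<sigma>) / (u + \<sigma>)"
  defines "A' \<equiv> - l / ((z - \<sigma>) * (z - \<sigma> + l)) / L" and "B' \<equiv> m / ((1 - z * \<sigma>) * (1 - z * \<sigma> + z * m)) / M"
  shows "\<sigma> < z" "z * \<sigma> < 1" "l / (z - \<sigma>) = l * \<sigma> / (1 - \<sigma>\<^sup>2) + l / (1 - \<sigma>\<^sup>2) * u"
    "z * m / (1 - z * \<sigma>) = m * \<sigma> / (1 - \<sigma>\<^sup>2) + m / (1 - \<sigma>\<^sup>2) * (1 / u)"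
    "A' < 0" "0 < B'" "s * A' + t * B' = 0"
    "((\<lambda>z. ln (1 + l / (z - \<sigma>)) / L) has_real_derivative A') (at z)"
    "((\<lambda>z. ln (1 + z * m / (1 - z * \<sigma>)) / M) has_real_derivative B') (at z)"
proof -
  have us: "0 < u + \<sigma>" using u \<sigma> by simp
  have q: "0 < 1 - \<sigma>\<^sup>2" using \<sigma> by (simp add: power_less_one_iff)
  have z1: "z - \<sigma> = (1 - \<sigma>\<^sup>2) / (u + \<sigma>)" using us by (simp add: z_def field_simps power2_eq_square)
  have z2: "1 - z * \<sigma> = u * (1 - \<sigma>\<^sup>2) / (u + \<sigma>)" using us by (simp add: z_def field_simps power2_eq_square)
  have p1: "0 < z - \<sigma>" unfolding z1 using q us by simp
  have p2: "0 < 1 - z * \<sigma>" unfolding z2 using q us u by simp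
  show "\<sigma> < z" "z * \<sigma> < 1" using p1 p2 by auto
  have z0: "0 < z" using p1 \<sigma> by simp
  show "l / (z - \<sigma>) = l * \<sigma> / (1 - \<sigma>\<^sup>2) + l / (1 - \<sigma>\<^sup>2) * u"
  proof -
    have "l / (K / (u + \<sigma>)) = l * \<sigma> / K + l / K * u" if "0 < K" for K
      using us that by (simp add: field_simps)
    then show ?thesis unfolding z1 using q by blast
  qed
  show "z * m / (1 - z * \<sigma>) = m * \<sigma> / (1 - \<sigma>\<^sup>2) + m / (1 - \<sigma>\<^sup>2) * (1 / u)"
  proof -
    have "(1 + u * \<sigma>) / v * m / (u * K / v) = m * \<sigma> / K + m / K * (1 / u)" if "0 < K" "0 < v" for K v
    proof -
      have "(1 + u * \<sigma>) / v * m / (u * K / v) = (1 + u * \<sigma>) * m / (u * K)" using that by simp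
      also have "\<dots> = m * \<sigma> / K + m / K * (1 / u)" using u that by (simp add: field_simps)
      finally show ?thesis .
    qed
    then show ?thesis unfolding z2 unfolding z_def using q us by blast
  qed
  show "A' < 0" unfolding A'_def using l p1 LM by (simp add: divide_neg_pos)
  have zm: "0 < z * m" using z0 m by simp
  show "0 < B'" unfolding B'_def using m p2 zm LM by simp
  have e1: "z - \<sigma> + l = (1 - \<sigma>\<^sup>2 + l * (u + \<sigma>)) / (u + \<sigma>)" unfolding z1 using us by (simp add: field_simps)
  have e2: "1 - z * \<sigma> + z * m = (u * (1 - \<sigma>\<^sup>2) + m * (1 + u * \<sigma>)) / (u + \<sigma>)"
  proof -
    have "u * (1 - \<sigma>\<^sup>2) / v + N / v * m = (u * (1 - \<sigma>\<^sup>2) + m * N) / v" for N v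
      by (simp add: add_divide_distrib mult.commute)
    then show ?thesis unfolding z2 unfolding z_def .
  qed
  define P where "P = 1 - \<sigma>\<^sup>2 + l * (u + \<sigma>)"
  define Q where "Q = u * (1 - \<sigma>\<^sup>2) + m * (1 + u * \<sigma>)"
  have PQ: "0 < P" "0 < Q" using q us u l m \<sigma> by (auto simp: P_def Q_def intro!: add_pos_pos mult_pos_pos)
  have key: "s * l * M * (u * Q) = t * m * L * P"
    using quad by (simp add: P_def Q_def algebra_simps power2_eq_square)
  show "s * A' + t * B' = 0"
  proof -
    define K where "K = 1 - \<sigma>\<^sup>2"
    define v where "v = u + \<sigma>"
    have Kv: "0 < K" "0 < v" using q us by (simp_all add: K_def v_def)
    have "(z - \<sigma>) * (z - \<sigma> + l) = (K / v) * (P / v)"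
      by (subst e1, subst z1) (simp add: K_def v_def P_def)
    then have A: "A' = - (v\<^sup>2 / K) * (s * l / (P * L)) / s"
      unfolding A'_def using Kv PQ LM st by (simp add: power2_eq_square mult_ac)
    have "(1 - z * \<sigma>) * (1 - z * \<sigma> + z * m) = (u * K / v) * (Q / v)"
      by (subst e2, subst z2) (simp add: K_def v_def Q_def)
    then have B: "B' = (v\<^sup>2 / K) * (t * m / (u * Q * M)) / t"
      unfolding B'_def using Kv PQ LM st u by (simp add: power2_eq_square mult_ac)
    have "t * m / (u * Q * M) = s * l / (P * L)"
      using key PQ LM u by (simp add: frac_eq_eq mult_ac)
    then show ?thesis unfolding A B using st by simp
  qed
  show "((\<lambda>z. ln (1 + l / (z - \<sigma>)) / L) has_real_derivative A') (at z)"
  proof -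
    have "((\<lambda>z. ln (1 + l / (z - \<sigma>)) / L) has_real_derivative
        (- l / (z - \<sigma>)\<^sup>2) / (1 + l / (z - \<sigma>)) / L) (at z)"
      using p1 l LM by (auto intro!: derivative_eq_intros add_pos_pos simp: power2_eq_square)
    also have "(- l / (z - \<sigma>)\<^sup>2) / (1 + l / (z - \<sigma>)) / L = A'"
      unfolding A'_def using p1 l LM by (simp add: divide_simps power2_eq_square)
    finally show ?thesis .
  qed
  show "((\<lambda>z. ln (1 + z * m / (1 - z * \<sigma>)) / M) has_real_derivative B') (at z)"
  proof -
    have "((\<lambda>z. ln (1 + z * m / (1 - z * \<sigma>)) / M) has_real_derivative
        (m * (1 - z * \<sigma>) + z * m * \<sigma>) / (1 - z * \<sigma>)\<^sup>2 / (1 + z * m / (1 - z * \<sigma>)) / M) (at z)"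
      using p2 zm LM by (auto intro!: derivative_eq_intros add_pos_pos simp: power2_eq_square)
    also have "(m * (1 - z * \<sigma>) + z * m * \<sigma>) / (1 - z * \<sigma>)\<^sup>2 / (1 + z * m / (1 - z * \<sigma>)) / M = B'"
    proof -
      have "m * (1 - z * \<sigma>) + z * m * \<sigma> = m" by (simp add: algebra_simps)
      moreover have "1 + z * m / (1 - z * \<sigma>) = (1 - z * \<sigma> + z * m) / (1 - z * \<sigma>)" using p2 by (simp add: field_simps)
      ultimately show ?thesis unfolding B'_def using p2 zm LM by (simp add: power2_eq_square)
    qed
    finally show ?thesis .
  qed
qed

text \<open>
  The reciprocal of the positive root has the same form, with \<open>P\<close> and \<open>Q\<close> exchanged and \<open>R\<close> negated; this
  is the symmetry between the two summands of the shape function.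
\<close>
lemma quadratic_root:
  fixes P Q R :: real
  assumes "0 < P" "0 < Q"
  defines "D \<equiv> sqrt (R\<^sup>2 + 4 * P * Q)"
  shows "0 < (R + D) / (2 * P)" "P * ((R + D) / (2 * P))\<^sup>2 - R * ((R + D) / (2 * P)) = Q"
    "1 / ((R + D) / (2 * P)) = (- R + D) / (2 * Q)"
proof -
  have PQ: "0 < P * Q" using assms by simp
  have D2: "D\<^sup>2 = R\<^sup>2 + 4 * P * Q" unfolding D_def using PQ by (simp add: mult.assoc)
  have "\<bar>R\<bar> = sqrt (R\<^sup>2)" by simp
  also have "\<dots> < D" unfolding D_def using PQ by (intro real_sqrt_less_mono) (simp add: mult.assoc)
  finally have RD: "\<bar>R\<bar> < D" .
  then have pos: "0 < R + D" by linarith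
  then show "0 < (R + D) / (2 * P)" using assms by simp
  have "P * ((R + D) / (2 * P))\<^sup>2 - R * ((R + D) / (2 * P)) = ((R + D)\<^sup>2 - 2 * R * (R + D)) / (4 * P)"
    using assms by (simp add: power2_eq_square field_simps)
  also have "(R + D)\<^sup>2 - 2 * R * (R + D) = D\<^sup>2 - R\<^sup>2" by (simp add: power2_eq_square algebra_simps)
  also have "(D\<^sup>2 - R\<^sup>2) / (4 * P) = Q" using D2 assms by simp
  finally show "P * ((R + D) / (2 * P))\<^sup>2 - R * ((R + D) / (2 * P)) = Q" .
  have "(- R + D) * (R + D) = 4 * P * Q" using D2 by (simp add: power2_eq_square algebra_simps)
  then show "1 / ((R + D) / (2 * P)) = (- R + D) / (2 * Q)"
    using pos assms by (simp add: field_simps)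
qed

theorem corollary2p8:
  fixes \<mu> :: "((nat \<Rightarrow> real) \<times> (nat \<Rightarrow> real)) measure"
    and g :: "real \<Rightarrow> real \<Rightarrow> ereal"
    and q l m :: real
  assumes "environment \<mu>"
    and "is_shape_function \<mu> g"
    and "0 < q" "q < 1"
    and "0 < l" "l < sqrt q"
    and "0 < m" "m < sqrt q"
    and "has_density_proportional_to (a_law \<mu>) (\<lambda>x. 1 / x) {sqrt q - l..sqrt q}"
    and "has_density_proportional_to (b_law \<mu>) (\<lambda>x. 1 / x) {sqrt q - m..sqrt q}"
  shows "\<forall>s>0. \<forall>t>0.
    (let L = ln (sqrt q / (sqrt q - l));
         M = ln (sqrt q / (sqrt q - m));
         x = s * l * M;
         y = t * m * L
     in g s t = ereal (
          s / L * ln (1 + l * sqrt q / (1 - q) + l / (1 - q) *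
            ((l * y - m * x + sqrt ((l * y - m * x)\<^sup>2
                + 4 * x * y * (1 + m * sqrt q - q) * (1 + l * sqrt q - q)))
             / (2 * x * (1 + m * sqrt q - q))))
        + t / M * ln (1 + m * sqrt q / (1 - q) + m / (1 - q) *
            ((m * x - l * y + sqrt ((l * y - m * x)\<^sup>2
                + 4 * x * y * (1 + m * sqrt q - q) * (1 + l * sqrt q - q)))
             / (2 * y * (1 + l * sqrt q - q))))))"
proof (intro allI impI)
  fix s t :: real
  assume st: "s > 0" "t > 0"
  define \<sigma> where "\<sigma> = sqrt q"
  have \<sigma>: "0 < \<sigma>" "\<sigma> < 1" "\<sigma>\<^sup>2 = q" using assms(3,4) by (auto simp: \<sigma>_def)
  have l: "0 < l" "l < \<sigma>" and m: "0 < m" "m < \<sigma>" using assms(5-8) by (auto simp: \<sigma>_def)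
  have dens: "has_density_proportional_to (a_law \<mu>) (\<lambda>x. 1 / x) {\<sigma> - l..\<sigma>}"
    "has_density_proportional_to (b_law \<mu>) (\<lambda>x. 1 / x) {\<sigma> - m..\<sigma>}"
    using assms(9,10) by (auto simp: \<sigma>_def)
  define L where "L = ln (\<sigma> / (\<sigma> - l))"
  define M where "M = ln (\<sigma> / (\<sigma> - m))"
  have LM: "0 < L" "0 < M" using l m \<sigma> by (auto simp: L_def M_def intro!: ln_gt_zero)
  define x where "x = s * l * M"
  define y where "y = t * m * L"
  have xy: "0 < x" "0 < y" using st l m LM by (auto simp: x_def y_def)
  define A where "A z = ln (1 + l / (z - \<sigma>)) / L" for z
  define B where "B z = ln (1 + z * m / (1 - z * \<sigma>)) / M" for z
  have pr: "prob_space \<mu>" and sets: "sets \<mu> = sets env_space" using assms(1) by (auto simp: environment_def)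
  have pa: "prob_space (a_law \<mu>)"
    unfolding a_law_def using measurable_env_coordinate(1)[OF sets, of 0]
    by (intro prob_space.prob_space_distr[OF pr]) (simp add: case_prod_unfold)
  have pb: "prob_space (b_law \<mu>)"
    unfolding b_law_def using measurable_env_coordinate(2)[OF sets, of 0]
    by (intro prob_space.prob_space_distr[OF pr]) (simp add: case_prod_unfold)
  have intA: "has_bochner_integral (a_law \<mu>) (\<lambda>x. x / (z - x)) (A z)" if z: "\<sigma> < z" "z * \<sigma> < 1" for z
  proof -
    have "has_bochner_integral (a_law \<mu>) (\<lambda>x. x / (z - x)) ((- ln (z - \<sigma>) - - ln (z - (\<sigma> - l))) / ln (\<sigma> / (\<sigma> - l)))"
    proof (rule reciprocal_density_integral[OF pa dens(1)])
      show "((\<lambda>x. - ln (z - x)) has_real_derivative x / (z - x) / x) (at x)" if "\<sigma> - l \<le> x" "x \<le> \<sigma>" for x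
        using that z l by (auto intro!: derivative_eq_intros simp: field_simps)
      show "continuous_on {\<sigma> - l..\<sigma>} (\<lambda>x. x / (z - x) / x)"
        using z l by (intro continuous_intros) auto
    qed (use l in auto)
    moreover have "- ln (z - \<sigma>) - - ln (z - (\<sigma> - l)) = ln (1 + l / (z - \<sigma>))"
    proof -
      have "1 + l / (z - \<sigma>) = (z - (\<sigma> - l)) / (z - \<sigma>)" using z by (simp add: field_simps)
      then show ?thesis using z l by (simp add: ln_div)
    qed
    ultimately show ?thesis by (simp add: A_def L_def)
  qed
  have intB: "has_bochner_integral (b_law \<mu>) (\<lambda>x. z * x / (1 - z * x)) (B z)" if z: "\<sigma> < z" "z * \<sigma> < 1" for z
  proof -
    have z0: "0 < z" using z \<sigma> by simp
    have lt: "z * x < 1" if "x \<le> \<sigma>" for x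
      using mult_left_mono[OF that, of z] z z0 by linarith
    have "has_bochner_integral (b_law \<mu>) (\<lambda>x. z * x / (1 - z * x)) ((- ln (1 - z * \<sigma>) - - ln (1 - z * (\<sigma> - m))) / ln (\<sigma> / (\<sigma> - m)))"
    proof (rule reciprocal_density_integral[OF pb dens(2)])
      show "((\<lambda>x. - ln (1 - z * x)) has_real_derivative z * x / (1 - z * x) / x) (at x)" if "\<sigma> - m \<le> x" "x \<le> \<sigma>" for x
        using that lt[of x] z m by (auto intro!: derivative_eq_intros simp: field_simps)
      show "continuous_on {\<sigma> - m..\<sigma>} (\<lambda>x. z * x / (1 - z * x) / x)"
        using lt m by (intro continuous_intros) (auto simp: less_imp_neq)
    qed (use m in auto)
    moreover have "- ln (1 - z * \<sigma>) - - ln (1 - z * (\<sigma> - m)) = ln (1 + z * m / (1 - z * \<sigma>))"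
    proof -
      have "1 + z * m / (1 - z * \<sigma>) = (1 - z * (\<sigma> - m)) / (1 - z * \<sigma>)" using z by (simp add: field_simps)
      then show ?thesis using z lt[of "\<sigma> - m"] m by (simp add: ln_div mult.commute)
    qed
    ultimately show ?thesis by (simp add: B_def M_def)
  qed
  define P where "P = x * (1 + m * \<sigma> - q)"
  define Q where "Q = y * (1 + l * \<sigma> - q)"
  define R where "R = l * y - m * x"
  define u where "u = (R + sqrt (R\<^sup>2 + 4 * P * Q)) / (2 * P)"
  have PQ: "0 < P" "0 < Q"
  proof -
    have "0 < m * \<sigma>" "0 < l * \<sigma>" using l m \<sigma> by simp_all
    then have "0 < 1 + m * \<sigma> - q" "0 < 1 + l * \<sigma> - q" using assms(4) by linarith+
    then show "0 < P" "0 < Q" unfolding P_def Q_def using xy by simp_all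
  qed
  note root = quadratic_root[OF PQ, of R, folded u_def]
  have quad: "s * l * M * (1 + m * \<sigma> - \<sigma>\<^sup>2) * u\<^sup>2 + (m * (s * l * M) - l * (t * m * L)) * u =
      t * m * L * (1 + l * \<sigma> - \<sigma>\<^sup>2)"
    using root(2) unfolding P_def Q_def R_def x_def y_def \<sigma>(3) by (simp add: algebra_simps)
  note cp = critical_point[OF \<sigma>(1,2) l m st LM root(1) quad]
  define z where "z = (1 + u * \<sigma>) / (u + \<sigma>)"
  have "g s t = ereal (s * A z + t * B z)"
    by (rule shape_at_critical_point[OF assms(1,2) \<sigma>(2) _ _ intA intB cp(1,2,8,5,9,6,7)[folded z_def A_def B_def] st])
      (use dens in \<open>auto intro: reciprocal_density_support\<close>)
  also have "s * A z = s / L * ln (1 + l * \<sigma> / (1 - q) + l / (1 - q) * u)"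
    using cp(3) by (simp add: A_def z_def \<sigma>(3) add.assoc)
  also have "t * B z = t / M * ln (1 + m * \<sigma> / (1 - q) + m / (1 - q) * ((- R + sqrt (R\<^sup>2 + 4 * P * Q)) / (2 * Q)))"
    using cp(4) root(3) by (simp add: B_def z_def \<sigma>(3) add.assoc)
  finally have "g s t = ereal (s / L * ln (1 + l * \<sigma> / (1 - q) + l / (1 - q) * u) +
      t / M * ln (1 + m * \<sigma> / (1 - q) + m / (1 - q) * ((- R + sqrt (R\<^sup>2 + 4 * P * Q)) / (2 * Q))))" .
  moreover have "R\<^sup>2 + 4 * P * Q = (l * y - m * x)\<^sup>2 + 4 * x * y * (1 + m * \<sigma> - q) * (1 + l * \<sigma> - q)"
    by (simp add: R_def P_def Q_def mult_ac)
  moreover have "- R = m * x - l * y" by (simp add: R_def)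
  moreover have "2 * P = 2 * x * (1 + m * \<sigma> - q)" "2 * Q = 2 * y * (1 + l * \<sigma> - q)" by (simp_all add: P_def Q_def)
  ultimately show "let L = ln (sqrt q / (sqrt q - l));
         M = ln (sqrt q / (sqrt q - m));
         x = s * l * M;
         y = t * m * L
     in g s t = ereal (
          s / L * ln (1 + l * sqrt q / (1 - q) + l / (1 - q) *
            ((l * y - m * x + sqrt ((l * y - m * x)\<^sup>2
                + 4 * x * y * (1 + m * sqrt q - q) * (1 + l * sqrt q - q)))
             / (2 * x * (1 + m * sqrt q - q))))
        + t / M * ln (1 + m * sqrt q / (1 - q) + m / (1 - q) *
            ((m * x - l * y + sqrt ((l * y - m * x)\<^sup>2
                + 4 * x * y * (1 + m * sqrt q - q) * (1 + l * sqrt q - q)))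
             / (2 * y * (1 + l * sqrt q - q)))))"
    unfolding Let_def \<sigma>_def[symmetric] L_def[symmetric] M_def[symmetric] x_def[symmetric] y_def[symmetric] u_def
    by (simp only: R_def)
qed

end
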